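(* Let $(\mathcal{R},\mu)$ be resonant, let $\|\cdot\|_X$ be an r.i. quasi-Banach function norm on $\mathcal{M}(\mathcal{R},\mu)$ with corresponding space $X$, and let $\|\cdot\|_{\overline{X}}$ be the r.i. quasi-Banach function norm on $\mathcal{M}([0,\infty),\lambda)$ constructed as in the context, with corresponding space $\overline{X}$. Then for every $f\in X$: $f\in X_a$ if and only if $f^*\in(\overline{X})_a$.
   Context: Let $(\mathcal{R},\mu)$ be a $\sigma$-finite measure space; $\mathcal{M}$ denotes the $\mu$-measurable extended complex-valued functions (identified a.e.), $\mathcal{M}_+$ the non-negative ones. $f_*(s)=\mu(\{|f|>s\})$, $f^*(t)=\inf\{s\ge0;\,f_*(s)\le t\}$ (non-increasing rearrangement). $(\mathcal{R},\mu)$ is called resonant if it is either non-atomic or completely atomic with all atoms of equal measure. A quasi-Banach function norm is a map $\|\cdot\|:\mathcal{M}\to[0,\infty]$ with $\|f\|=\||f|\|$ such that on $\mathcal{M}_+$: (Q1) $\|af\|=|a|\|f\|$, $\|f\|=0\iff f=0$ a.e., and there is $C\ge1$ (modulus of concavity) with $\|f+g\|\le C(\|f\|+\|g\|)$; (P2) $f\le g$ a.e. implies $\|f\|\le\|g\|$; (P3) $f_n\uparrow f$ a.e. implies $\|f_n\|\uparrow\|f\|$; (P4) $\|\chi_E\|<\infty$ whenever $\mu(E)<\infty$. The norm is rearrangement-invariant (r.i.) if $\|f\|=\|g\|$ whenever $f^*=g^*$. The corresponding space is $X=\{f\in\mathcal{M};\,\|f\|_X<\infty\}$. A function $f\in X$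 has absolutely continuous quasinorm if $\|f\chi_{E_k}\|_X\to0$ for every sequence of measurable sets $E_k$ with $\chi_{E_k}\to0$ a.e.; $X_a$ denotes the set of such functions (analogously $(\overline{X})_a$ over $([0,\infty),\lambda)$). Construction of $\|\cdot\|_{\overline{X}}$: (i) If $(\mathcal{R},\mu)$ is non-atomic, fix a measure-preserving map $\sigma$ from $(\mathcal{R},\mu)$ onto $[0,\mu(\mathcal{R}))$ (with Lebesgue measure $\lambda$), and for $h\in\mathcal{M}([0,\mu(\mathcal{R})),\lambda)$ put $\|h\|_{\overline{X_0}}=\|h\circ\sigma\|_X$. (ii) If $(\mathcal{R},\mu)$ is completely atomic with all atoms of measure $\beta\in(0,\infty)$, fix an enumeration $(e_n)_{n\in\mathcal{N}}$ of the atoms, $\mathcal{N}=\{n\in\mathbb{N};\,\beta n<\mu(\mathcal{R})\}$ ($0\in\mathbb{N}$), define $T(h)(e_n)=\beta^{-1}\int_{\beta n}^{\beta(n+1)}h^*\,d\lambda$ for $n\in\mathcal{N}$, and put $\|h\|_{\overline{X_0}}=\|T(h)\|_X$. In both cases define, for $f\in\mathcal{M}([0,\infty),\lambda)$, $\|f\|_{\overline{X}}=\|f^*\chi_{[0,\mu(\mathcal{R}))}\|_{\overline{X_0}}$. (This is an r.i. quasi-Banach function norm with $\|f\|_X=\|f^*\|_{\overline{X}}$ for $f\in\mathcal{M}(\mathcal{R},\mu)$.) *)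

theory Defs
  imports "HOL-Analysis.Analysis"
begin

text \<open>Functions in M_+ are represented as extended non-negative valued functions
  (type ennreal); since the quasinorm satisfies norm f = norm |f| and all notions
  in the statement depend only on |f|, a complex-valued f is represented by |f|.\<close>

definition distrib_fun :: "'a measure \<Rightarrow> ('a \<Rightarrow> ennreal) \<Rightarrow> real \<Rightarrow> ennreal" where
  "distrib_fun M f s = emeasure M {x \<in> space M. f x > ennreal s}"

definition rearr :: "'a measure \<Rightarrow> ('a \<Rightarrow> ennreal) \<Rightarrow> real \<Rightarrow> ennreal" where
  "rearr M f t = Inf (ennreal ` {s::real. 0 \<le> s \<and> distrib_fun M f s \<le> ennreal t})"

abbreviation halfline :: "real measure" where
  "halfline \<equiv> lebesgue_on {0..}"

definition qBFN :: "'a measure \<Rightarrow> (('a \<Rightarrow> ennreal) \<Rightarrow> ennreal) \<Rightarrow> bool" where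
  "qBFN M N \<longleftrightarrow>
     (\<forall>f \<in> borel_measurable M. \<forall>a::real. a \<ge> 0 \<longrightarrow> N (\<lambda>x. ennreal a * f x) = ennreal a * N f)
   \<and> (\<forall>f \<in> borel_measurable M. N f = 0 \<longleftrightarrow> (AE x in M. f x = 0))
   \<and> (\<exists>C::real. C \<ge> 1 \<and> (\<forall>f \<in> borel_measurable M. \<forall>g \<in> borel_measurable M.
          N (\<lambda>x. f x + g x) \<le> ennreal C * (N f + N g)))
   \<and> (\<forall>f \<in> borel_measurable M. \<forall>g \<in> borel_measurable M.
          (AE x in M. f x \<le> g x) \<longrightarrow> N f \<le> N g)
   \<and> (\<forall>fs f. (\<forall>n. fs n \<in> borel_measurable M) \<longrightarrow> f \<in> borel_measurable M \<longrightarrow>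
          (AE x in M. (\<forall>n. fs n x \<le> fs (Suc n) x) \<and> (\<lambda>n. fs n x) \<longlonglongrightarrow> f x) \<longrightarrow>
          (\<lambda>n. N (fs n)) \<longlonglongrightarrow> N f)
   \<and> (\<forall>E \<in> sets M. emeasure M E < \<infinity> \<longrightarrow> N (indicator E) < \<infinity>)"

definition rinv :: "'a measure \<Rightarrow> (('a \<Rightarrow> ennreal) \<Rightarrow> ennreal) \<Rightarrow> bool" where
  "rinv M N \<longleftrightarrow> (\<forall>f \<in> borel_measurable M. \<forall>g \<in> borel_measurable M.
      (\<forall>t\<ge>0. rearr M f t = rearr M g t) \<longrightarrow> N f = N g)"

definition abs_cont :: "'a measure \<Rightarrow> (('a \<Rightarrow> ennreal) \<Rightarrow> ennreal) \<Rightarrow> ('a \<Rightarrow> ennreal) \<Rightarrow> bool" where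
  "abs_cont M N f \<longleftrightarrow> f \<in> borel_measurable M \<and> N f < \<infinity> \<and>
     (\<forall>E :: nat \<Rightarrow> 'a set. (\<forall>k. E k \<in> sets M) \<longrightarrow>
        (AE x in M. (\<lambda>k. indicator (E k) x :: real) \<longlonglongrightarrow> 0) \<longrightarrow>
        (\<lambda>k. N (\<lambda>x. f x * indicator (E k) x)) \<longlonglongrightarrow> 0)"

definition atom :: "'a measure \<Rightarrow> 'a set \<Rightarrow> bool" where
  "atom M A \<longleftrightarrow> A \<in> sets M \<and> 0 < emeasure M A \<and>
     (\<forall>B \<in> sets M. B \<subseteq> A \<longrightarrow> emeasure M B = 0 \<or> emeasure M B = emeasure M A)"

definition nonatomic :: "'a measure \<Rightarrow> bool" where
  "nonatomic M \<longleftrightarrow> \<not> (\<exists>A. atom M A)"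

definition total_interval :: "'a measure \<Rightarrow> real set" where
  "total_interval M = {t. 0 \<le> t \<and> ennreal t < emeasure M (space M)}"

definition measure_preserving :: "'a measure \<Rightarrow> ('a \<Rightarrow> real) \<Rightarrow> bool" where
  "measure_preserving M \<sigma> \<longleftrightarrow> (\<forall>x \<in> space M. \<sigma> x \<in> total_interval M) \<and>
     (\<forall>E \<in> sets lborel. E \<subseteq> total_interval M \<longrightarrow>
        \<sigma> -` E \<inter> space M \<in> sets M \<and> emeasure M (\<sigma> -` E \<inter> space M) = emeasure lborel E)"

definition Xbar0_nonatomic :: "(('a \<Rightarrow> ennreal) \<Rightarrow> ennreal) \<Rightarrow> ('a \<Rightarrow> real)
    \<Rightarrow> (real \<Rightarrow> ennreal) \<Rightarrow> ennreal" where
  "Xbar0_nonatomic N \<sigma> h = N (h \<circ> \<sigma>)"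

text \<open>Case (ii): completely atomic, atoms e n (n in the index set) of measure beta.\<close>
definition atom_index :: "'a measure \<Rightarrow> real \<Rightarrow> nat set" where
  "atom_index M \<beta> = {n. ennreal (\<beta> * real n) < emeasure M (space M)}"

definition T_op :: "'a measure \<Rightarrow> real \<Rightarrow> (nat \<Rightarrow> 'a set) \<Rightarrow> (real \<Rightarrow> ennreal) \<Rightarrow> 'a \<Rightarrow> ennreal" where
  "T_op M \<beta> e h x = (\<Sum>n. if n \<in> atom_index M \<beta> then
      indicator (e n) x * ((\<integral>\<^sup>+ t. rearr halfline h t * indicator {\<beta> * real n ..< \<beta> * real (Suc n)} t \<partial>lborel)
                           / ennreal \<beta>)
      else 0)"

definition Xbar0_atomic :: "'a measure \<Rightarrow> (('a \<Rightarrow> ennreal) \<Rightarrow> ennreal) \<Rightarrow> real \<Rightarrow> (nat \<Rightarrow> 'a set)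
    \<Rightarrow> (real \<Rightarrow> ennreal) \<Rightarrow> ennreal" where
  "Xbar0_atomic M N \<beta> e h = N (T_op M \<beta> e h)"

definition Xbar_of :: "'a measure \<Rightarrow> ((real \<Rightarrow> ennreal) \<Rightarrow> ennreal) \<Rightarrow> (real \<Rightarrow> ennreal) \<Rightarrow> ennreal" where
  "Xbar_of M N0 f = N0 (\<lambda>t. rearr halfline f t * indicator (total_interval M) t)"

text \<open>Nbar arises from N by the construction of the context, for some admissible choice
  of the data: a measure-preserving map in the non-atomic case, or an enumeration of
  the atoms in the completely atomic case with all atoms of measure beta.
  (M resonant is encoded by requiring one of these two cases.)\<close>
definition Xbar_construction :: "'a measure \<Rightarrow> (('a \<Rightarrow> ennreal) \<Rightarrow> ennreal)
    \<Rightarrow> ((real \<Rightarrow> ennreal) \<Rightarrow> ennreal) \<Rightarrow> bool" where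
  "Xbar_construction M N Nbar \<longleftrightarrow>
     (\<exists>\<sigma>. nonatomic M \<and> measure_preserving M \<sigma> \<and> Nbar = Xbar_of M (Xbar0_nonatomic N \<sigma>))
   \<or> (\<exists>\<beta> e. 0 < \<beta> \<and>
        (\<forall>n \<in> atom_index M \<beta>. atom M (e n) \<and> emeasure M (e n) = ennreal \<beta>) \<and>
        disjoint_family_on e (atom_index M \<beta>) \<and>
        (\<Union>n \<in> atom_index M \<beta>. e n) = space M \<and>
        Nbar = Xbar_of M (Xbar0_atomic M N \<beta> e))"

end

theory Submission
  imports Defs
begin

text \<open>The norm of Xbar sees p only through p*, and it assigns to f* the norm of f. If f is in X_a or
  f* is in (Xbar)_a, then f_*(s) is finite for s > 0, and the norms of the parts of f above n and
  below 1/n tend to 0 (for f* these parts are equimeasurable with those of f). Since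
  min(f, s) \<le> \<epsilon> f + f 1_{0 < f \<le> s/\<epsilon>}, also min(f, s) tends to 0 in norm as s \<rightarrow> 0. Conversely, for sets
  E_k whose indicators tend to 0 a.e., finiteness of f_* shows that the rearrangements h_k of
  f 1_{E_k} or of f* 1_{E_k} tend to 0 at every t > 0, and they are dominated by f*. In the non-atomic case
  h_k \<le> f* 1_{f* > S} + S 1_[0,\<delta>) + min(f*, h_k(\<delta>)), where 1_[0,\<delta>) is small in norm because f dominates
  multiples of indicators of small sets; in the atomic case T(h_k) \<le> min(T(f*), T(h_k)(e_0)).
  Every term is small, so one hypothesis yields both conclusions.\<close>

section \<open>Rearrangements\<close>

text \<open>Absolute continuity concerns products of f with indicators, but the rearrangement of f
  1_E is in general not f* times an indicator. Sets are therefore never transported between the two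
  spaces; the two sides are linked only by equimeasurability. What remains is a dominated
  convergence statement for decreasing h_k below f*, and the cuts at level sets are the products
  from which it can be drawn. The truncation min(f, s) is not such a product, so where f is large it
  is absorbed by a small multiple of f. Finiteness of f_* is essential: the constant 1 on the
  half-line times the indicator of [k, \<infinity>) has rearrangement 1 for every k. The same
  example proves finiteness, since an infinite f_*(s) gives products with vanishing indicators whose
  norms stay above that of the constant s. At t = 0 the convergence of h_k may fail, because h_k(0)
  is an essential supremum. In the non-atomic case the initial segment absorbs this; in the atomic
  case every f of finite norm is essentially bounded, so that the average over the first block still
  tends to 0.\<close>

lemma ennreal_le_if_less:
  fixes a b :: ennreal
  assumes "\<And>s::real. 0 \<le> s \<Longrightarrow> ennreal s < a \<Longrightarrow> ennreal s < b"
  shows "a \<le> b"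
proof (rule ccontr)
  assume "\<not> a \<le> b"
  then obtain c where c: "b < c" "c < a" using dense[of b a] by (auto simp: not_le)
  then obtain s where "0 \<le> s" "c = ennreal s" by (cases c) auto
  with assms[of s] c show False by auto
qed

lemma ennreal_eq_if_less:
  fixes a b :: ennreal
  assumes "\<And>s::real. 0 \<le> s \<Longrightarrow> ennreal s < a \<longleftrightarrow> ennreal s < b"
  shows "a = b"
  by (rule antisym; rule ennreal_le_if_less) (use assms in blast)+

text \<open>The factor \<open>D\<close> absorbs the constants that accumulate from the
  quasi-triangle inequality.\<close>

lemma tendsto_0_ennrealI:
  fixes X :: "'b \<Rightarrow> ennreal"
  assumes "\<And>e::real. e > 0 \<Longrightarrow> eventually (\<lambda>k. X k \<le> ennreal (D * e)) F" "D > 0"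
  shows "(X \<longlongrightarrow> 0) F"
proof (rule order_tendstoI)
  fix a :: ennreal assume "0 < a"
  then obtain c where c: "0 < c" "c < a" using dense by blast
  then obtain s where s: "0 < s" "c = ennreal s" by (cases c) auto
  have "eventually (\<lambda>k. X k \<le> ennreal (D * (s / D))) F" using s(1) assms(2) by (intro assms(1)) simp
  then show "eventually (\<lambda>k. X k < a) F"
    by eventually_elim (use s c assms(2) in \<open>auto intro: le_less_trans\<close>)
qed auto

lemma distrib_fun_antimono:
  assumes "f \<in> borel_measurable M" "s \<le> s'"
  shows "distrib_fun M f s' \<le> distrib_fun M f s"
  unfolding distrib_fun_def
  by (rule emeasure_mono) (use assms in \<open>auto intro: le_less_trans ennreal_leI\<close>)

text \<open>The infimum defining f* is attained because f_* is right-continuous: the sets f > s +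
  1/(n+1) increase to f > s, and the measure is continuous along them. Most later arguments use this
  equivalence instead of the infimum. Negative t are harmless, since \<open>ennreal t\<close> is
  then 0 on both sides.\<close>

lemma less_rearr_iff:
  assumes f[measurable]: "f \<in> borel_measurable M" and s: "0 \<le> s"
  shows "ennreal s < rearr M f t \<longleftrightarrow> ennreal t < distrib_fun M f s"
proof -
  have "rearr M f t \<le> ennreal s \<longleftrightarrow> distrib_fun M f s \<le> ennreal t"
  proof
    assume "distrib_fun M f s \<le> ennreal t"
    then show "rearr M f t \<le> ennreal s"
      unfolding rearr_def using s by (intro Inf_lower) auto
  next
    assume le: "rearr M f t \<le> ennreal s"
    let ?A = "\<lambda>n. {x \<in> space M. f x > ennreal (s + 1 / real (Suc n))}"
    have "emeasure M (?A n) \<le> ennreal t" for n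
    proof -
      have "rearr M f t < ennreal (s + 1 / real (Suc n))"
        using le s by (auto intro!: le_less_trans[OF le] simp: ennreal_less_iff)
      then obtain s' where s': "0 \<le> s'" "distrib_fun M f s' \<le> ennreal t"
          "ennreal s' < ennreal (s + 1 / real (Suc n))"
        unfolding rearr_def Inf_less_iff by auto
      then have "s' \<le> s + 1 / real (Suc n)" by (simp add: ennreal_less_iff)
      from distrib_fun_antimono[OF f this] s' show ?thesis
        unfolding distrib_fun_def by auto
    qed
    moreover have "incseq ?A"
    proof (rule incseq_SucI, safe)
      fix n x assume "ennreal (s + 1 / real (Suc n)) < f x"
      moreover have "ennreal (s + 1 / real (Suc (Suc n))) \<le> ennreal (s + 1 / real (Suc n))"
        by (intro ennreal_leI add_left_mono divide_left_mono) auto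
      ultimately show "ennreal (s + 1 / real (Suc (Suc n))) < f x" by (rule le_less_trans[rotated])
    qed
    then have "(SUP n. emeasure M (?A n)) = emeasure M (\<Union>n. ?A n)"
      by (intro SUP_emeasure_incseq) auto
    moreover have "(\<Union>n. ?A n) = {x \<in> space M. f x > ennreal s}"
    proof safe
      fix x n assume "ennreal (s + 1 / real (Suc n)) < f x"
      then show "ennreal s < f x"
        by (rule le_less_trans[rotated]) (auto intro!: ennreal_leI)
    next
      fix x assume "x \<in> space M" "ennreal s < f x"
      then obtain c where c: "ennreal s < c" "c < f x" using dense by blast
      then obtain r where r: "0 \<le> r" "c = ennreal r" by (cases c) auto
      with c s have "r - s > 0" by (simp add: ennreal_less_iff)
      then obtain n where "inverse (real (Suc n)) < r - s" using reals_Archimedean by blast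
      then have "ennreal (s + 1 / real (Suc n)) \<le> c"
        using r by (auto intro!: ennreal_leI simp: field_simps)
      then have "ennreal (s + 1 / real (Suc n)) < f x" using c(2) by (rule le_less_trans)
      then show "x \<in> (\<Union>n. {x \<in> space M. ennreal (s + 1 / real (Suc n)) < f x})"
        using \<open>x \<in> space M\<close> by blast
    qed
    ultimately show "distrib_fun M f s \<le> ennreal t"
      unfolding distrib_fun_def by (metis (no_types, lifting) SUP_least)
  qed
  then show ?thesis by (simp add: not_le[symmetric])
qed

lemma rearr_antimono:
  assumes "f \<in> borel_measurable M" "t \<le> t'"
  shows "rearr M f t' \<le> rearr M f t"
  by (rule ennreal_le_if_less)
    (use assms in \<open>auto simp: less_rearr_iff intro: le_less_trans[OF ennreal_leI]\<close>)

lemma rearr_mono_distrib: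
  assumes "f \<in> borel_measurable M" "g \<in> borel_measurable K"
    and "\<And>s. 0 \<le> s \<Longrightarrow> distrib_fun M f s \<le> distrib_fun K g s"
  shows "rearr M f t \<le> rearr K g t"
  by (rule ennreal_le_if_less) (use assms in \<open>auto simp: less_rearr_iff intro: less_le_trans\<close>)

lemma rearr_cong_distrib:
  assumes "f \<in> borel_measurable M" "g \<in> borel_measurable K"
    and "\<And>s. 0 \<le> s \<Longrightarrow> distrib_fun M f s = distrib_fun K g s"
  shows "rearr M f t = rearr K g t"
  by (rule ennreal_eq_if_less) (use assms in \<open>auto simp: less_rearr_iff\<close>)

lemma rearr_mono:
  assumes "f \<in> borel_measurable M" "g \<in> borel_measurable M" "\<And>x. x \<in> space M \<Longrightarrow> f x \<le> g x"
  shows "rearr M f t \<le> rearr M g t"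
  by (rule rearr_mono_distrib)
    (use assms in \<open>auto simp: distrib_fun_def intro!: emeasure_mono intro: less_le_trans\<close>)

section \<open>Initial intervals of the half-line and the distribution function of f*\<close>

lemma ennreal_less_set_eq:
  fixes a :: ennreal
  shows "{t. 0 \<le> t \<and> ennreal t < a} = (if a = \<infinity> then {0..} else {0..<enn2real a})"
  by (cases a) (auto simp: ennreal_less_iff ennreal_less_top)

lemma ennreal_less_set_borel: "{t. 0 \<le> t \<and> ennreal t < a} \<in> sets borel"
  by (simp add: ennreal_less_set_eq)

text \<open>With a = f_*(s) this is the level set where f* > s, so the computation is what makes f*
  equimeasurable with f, also when f_*(s) is infinite.\<close>

lemma emeasure_lborel_ennreal_less_set: "emeasure lborel {t. 0 \<le> t \<and> ennreal t < a} = a"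
proof (cases a)
  case top
  have "emeasure lborel {0::real..} = \<infinity>"
  proof (rule ccontr)
    assume *: "emeasure lborel {0::real..} \<noteq> \<infinity>"
    have "ennreal (real n) \<le> emeasure lborel {0::real..}" for n
      using emeasure_mono[of "{0..real n}" "{0::real..}" lborel] by simp
    with * show False
      by (metis ennreal_Ex_less_of_nat ennreal_of_nat_eq_real_of_nat infinity_ennreal_def leD top.not_eq_extremum)
  qed
  then show ?thesis unfolding ennreal_less_set_eq using top by simp
qed (auto simp: ennreal_less_set_eq)

lemma borel_sets_halfline: "A \<in> sets borel \<Longrightarrow> A \<subseteq> {0..} \<Longrightarrow> A \<in> sets halfline"
  by (auto simp: sets_restrict_space_iff)

lemma emeasure_halfline_borel:
  assumes "A \<in> sets borel" "A \<subseteq> {0..}"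
  shows "emeasure halfline A = emeasure lborel A"
  using assms by (simp add: emeasure_restrict_space)

lemma borel_measurable_halfline:
  assumes "g \<in> borel_measurable borel" shows "g \<in> borel_measurable halfline"
proof -
  have "g \<in> borel_measurable lebesgue" using assms by (simp add: measurable_completion)
  then show ?thesis by (rule measurable_restrict_space1)
qed

lemma rearr_borel_measurable:
  assumes "f \<in> borel_measurable M"
  shows "rearr M f \<in> borel_measurable borel"
proof (rule borel_measurableI_greater)
  fix a :: ennreal
  show "{w \<in> space borel. a < rearr M f w} \<in> sets borel"
  proof (cases a)
    case (real s)
    then have "{w \<in> space borel. a < rearr M f w} = {w. ennreal w < distrib_fun M f s}"
      using less_rearr_iff[OF assms, of s] by auto
    also have "\<dots> \<in> sets borel" by measurable
    finally show ?thesis .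
  qed auto
qed

lemmas rearr_measurable_halfline = rearr_borel_measurable[THEN borel_measurable_halfline]

lemma distrib_rearr:
  assumes "f \<in> borel_measurable M" "0 \<le> s"
  shows "distrib_fun halfline (rearr M f) s = distrib_fun M f s"
proof -
  have "{x \<in> space halfline. ennreal s < rearr M f x} = {t. 0 \<le> t \<and> ennreal t < distrib_fun M f s}"
    using less_rearr_iff[OF assms] by (auto simp: space_restrict_space)
  then show ?thesis
    unfolding distrib_fun_def[of halfline]
    by (simp add: emeasure_halfline_borel ennreal_less_set_borel emeasure_lborel_ennreal_less_set
        subset_eq)
qed

lemma rearr_rearr:
  assumes "f \<in> borel_measurable M"
  shows "rearr halfline (rearr M f) t = rearr M f t"
  by (rule rearr_cong_distrib) (use assms in \<open>auto simp: distrib_rearr rearr_measurable_halfline\<close>)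

section \<open>Sets whose indicators tend to 0 almost everywhere\<close>

lemma emeasure_vanishing_sets:
  assumes A[measurable]: "A \<in> sets K" and fin: "emeasure K A < \<infinity>"
    and E[measurable]: "\<And>k::nat. E k \<in> sets K"
    and AE: "AE x in K. (\<lambda>k. indicator (E k) x :: real) \<longlonglongrightarrow> 0"
  shows "(\<lambda>k. emeasure K (A \<inter> E k)) \<longlonglongrightarrow> 0"
proof -
  have "(\<lambda>k. \<integral>\<^sup>+ x. indicator (A \<inter> E k) x \<partial>K) \<longlonglongrightarrow> (\<integral>\<^sup>+ x. 0 \<partial>K)"
  proof (rule nn_integral_dominated_convergence[where w = "indicator A"])
    show "AE x in K. (\<lambda>i. indicator (A \<inter> E i) x :: ennreal) \<longlonglongrightarrow> 0"
      using AE
    proof eventually_elim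
      case (elim x)
      then have "eventually (\<lambda>k. indicator (E k) x < (1::real)) sequentially"
        by (rule order_tendstoD) simp
      then have "eventually (\<lambda>k. indicator (A \<inter> E k) x = (0::ennreal)) sequentially"
        by eventually_elim (auto split: split_indicator_asm split: split_indicator)
      then show ?case by (rule tendsto_eventually)
    qed
  qed (use fin in \<open>auto split: split_indicator\<close>)
  then show ?thesis by simp
qed

text \<open>The product f 1_{E_k} exceeds e only on the part of E_k inside the set f > e. That set
  has finite measure, so the part eventually has measure below t, and then the rearrangement at t is
  at most e.\<close>

lemma rearr_vanishing_sets:
  assumes f[measurable]: "f \<in> borel_measurable K"
    and fin: "\<And>s. s > 0 \<Longrightarrow> distrib_fun K f s < \<infinity>"
    and E[measurable]: "\<And>k::nat. E k \<in> sets K"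
    and AE: "AE x in K. (\<lambda>k. indicator (E k) x :: real) \<longlonglongrightarrow> 0"
    and t: "t > 0"
  shows "(\<lambda>k. rearr K (\<lambda>x. f x * indicator (E k) x) t) \<longlonglongrightarrow> 0"
proof (rule tendsto_0_ennrealI[where D = 1])
  fix e :: real assume e: "e > 0"
  let ?A = "{x \<in> space K. f x > ennreal e}"
  have "(\<lambda>k. emeasure K (?A \<inter> E k)) \<longlonglongrightarrow> 0"
    by (rule emeasure_vanishing_sets) (use fin[OF e] AE in \<open>auto simp: distrib_fun_def\<close>)
  then have "eventually (\<lambda>k. emeasure K (?A \<inter> E k) < ennreal t) sequentially"
    by (rule order_tendstoD) (use t in simp)
  then show "eventually (\<lambda>k. rearr K (\<lambda>x. f x * indicator (E k) x) t \<le> ennreal (1 * e)) sequentially"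
  proof eventually_elim
    case (elim k)
    have "{x \<in> space K. ennreal e < f x * indicator (E k) x} = ?A \<inter> E k"
      by (auto split: split_indicator_asm)
    then show ?case
      using elim less_rearr_iff[of "\<lambda>x. f x * indicator (E k) x" K e t] e
      by (auto simp: distrib_fun_def not_less[symmetric])
  qed
qed simp

section \<open>Quasi-Banach function norms\<close>

lemma qBFN_scale:
  "qBFN M N \<Longrightarrow> f \<in> borel_measurable M \<Longrightarrow> 0 \<le> a \<Longrightarrow> N (\<lambda>x. ennreal a * f x) = ennreal a * N f"
  unfolding qBFN_def by blast

lemma qBFN_eq_0_iff:
  "qBFN M N \<Longrightarrow> f \<in> borel_measurable M \<Longrightarrow> N f = 0 \<longleftrightarrow> (AE x in M. f x = 0)"
  unfolding qBFN_def by blast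

lemma qBFN_triangle:
  assumes "qBFN M N"
  obtains C :: real where "C \<ge> 1"
    and "\<And>f g. f \<in> borel_measurable M \<Longrightarrow> g \<in> borel_measurable M \<Longrightarrow>
      N (\<lambda>x. f x + g x) \<le> ennreal C * (N f + N g)"
proof -
  have "\<exists>C::real. C \<ge> 1 \<and> (\<forall>f \<in> borel_measurable M. \<forall>g \<in> borel_measurable M.
          N (\<lambda>x. f x + g x) \<le> ennreal C * (N f + N g))"
    using assms unfolding qBFN_def by (elim conjE)
  then show thesis using that by blast
qed

lemma qBFN_mono_AE:
  "qBFN M N \<Longrightarrow> f \<in> borel_measurable M \<Longrightarrow> g \<in> borel_measurable M \<Longrightarrow>
    AE x in M. f x \<le> g x \<Longrightarrow> N f \<le> N g"
  unfolding qBFN_def by blast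

lemma qBFN_mono:
  "qBFN M N \<Longrightarrow> f \<in> borel_measurable M \<Longrightarrow> g \<in> borel_measurable M \<Longrightarrow>
    (\<And>x. x \<in> space M \<Longrightarrow> f x \<le> g x) \<Longrightarrow> N f \<le> N g"
  by (intro qBFN_mono_AE[of M N f g] AE_I2)

lemma ennreal_bounded_multiples_eq_0:
  fixes c d :: ennreal
  assumes "\<And>n::nat. of_nat n * c \<le> d" "d < \<infinity>"
  shows "c = 0"
proof (rule ccontr)
  assume c: "c \<noteq> 0"
  have "c \<noteq> \<infinity>" using assms(1)[of 1] assms(2) by (auto simp: top_unique)
  then obtain r where r: "c = ennreal r" "r > 0" using c by (cases c) auto
  obtain D where D: "d = ennreal D" "D \<ge> 0" using assms(2) by (cases d) auto
  obtain n :: nat where "D / r < real n" using reals_Archimedean2 by blast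
  then have "D < real n * r" using r by (simp add: field_simps)
  moreover have "ennreal (real n * r) \<le> ennreal D"
    using assms(1)[of n] r D by (simp add: ennreal_of_nat_eq_real_of_nat ennreal_mult')
  ultimately show False using D r by simp
qed

text \<open>Every multiple n of the indicator of f = \<infinity> lies below f, so all multiples of
  its norm lie below one finite number and the norm is 0.\<close>

lemma qBFN_finite_AE:
  assumes q: "qBFN M N" and f[measurable]: "f \<in> borel_measurable M" and fin: "N f < \<infinity>"
  shows "AE x in M. f x < \<infinity>"
proof -
  let ?B = "indicator {x \<in> space M. f x = \<infinity>} :: 'a \<Rightarrow> ennreal"
  have "of_nat n * N ?B \<le> N f" for n
  proof -
    have "ennreal (real n) * N ?B = N (\<lambda>x. ennreal (real n) * ?B x)"
      by (rule qBFN_scale[OF q, symmetric]) auto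
    also have "\<dots> \<le> N f"
      by (rule qBFN_mono[OF q]) (auto split: split_indicator)
    finally show ?thesis by (simp add: ennreal_of_nat_eq_real_of_nat)
  qed
  then have "N ?B = 0" using fin by (rule ennreal_bounded_multiples_eq_0)
  then have "AE x in M. ?B x = 0" by (subst (asm) qBFN_eq_0_iff[OF q]) auto
  with AE_space show ?thesis
    by eventually_elim (auto simp: less_top[symmetric] split: split_indicator_asm)
qed

section \<open>Level cuts and absolute continuity\<close>

definition upper_cut :: "'a measure \<Rightarrow> ('a \<Rightarrow> ennreal) \<Rightarrow> real \<Rightarrow> 'a \<Rightarrow> ennreal" where
  "upper_cut M f s x = f x * indicator {x \<in> space M. ennreal s < f x} x"

text \<open>The condition 0 < f does not change the product, but it makes the indicators tend to 0
  at every point as s tends to 0; on the zero set of f the indicator of f \<le> s would stay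
  1.\<close>

definition lower_cut :: "'a measure \<Rightarrow> ('a \<Rightarrow> ennreal) \<Rightarrow> real \<Rightarrow> 'a \<Rightarrow> ennreal" where
  "lower_cut M f s x = f x * indicator {x \<in> space M. 0 < f x \<and> f x \<le> ennreal s} x"

lemma measurable_cut [measurable]:
  assumes [measurable]: "f \<in> borel_measurable M"
  shows "upper_cut M f s \<in> borel_measurable M" "lower_cut M f s \<in> borel_measurable M"
  unfolding upper_cut_def lower_cut_def by measurable

lemma distrib_upper_cut:
  assumes "0 \<le> s" "0 \<le> S"
  shows "distrib_fun M (upper_cut M f S) s = distrib_fun M f (max s S)"
proof -
  have "{x \<in> space M. ennreal s < upper_cut M f S x} = {x \<in> space M. ennreal (max s S) < f x}"
    using assms by (auto simp: upper_cut_def ennreal_max_0 max_of_mono[OF monoI[of ennreal], symmetric]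
        ennreal_leI split: split_indicator_asm split: split_indicator)
  then show ?thesis by (simp add: distrib_fun_def)
qed

text \<open>The right-hand side involves only the distribution function of f, so that cuts of f and
  of f* are equimeasurable. Finiteness allows the measures to be subtracted; for s > u the
  difference is 0, as it should be.\<close>

lemma distrib_lower_cut:
  assumes [measurable]: "f \<in> borel_measurable M" and s: "0 \<le> s" "0 \<le> u"
    and fin: "distrib_fun M f u < \<infinity>"
  shows "distrib_fun M (lower_cut M f u) s = distrib_fun M f s - distrib_fun M f u"
proof -
  have *: "{x \<in> space M. ennreal s < lower_cut M f u x}
      = {x \<in> space M. ennreal s < f x} - {x \<in> space M. ennreal u < f x}" (is "_ = ?A - ?B")
    using s by (auto simp: lower_cut_def not_less zero_less_iff_neq_zero
        split: split_indicator_asm split: split_indicator)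
  show ?thesis
  proof (cases "s \<le> u")
    case True
    then have "?B \<subseteq> ?A" by (auto intro: le_less_trans ennreal_leI)
    then have "emeasure M (?A - ?B) = emeasure M ?A - emeasure M ?B"
      using fin by (intro emeasure_Diff) (auto simp: distrib_fun_def)
    then show ?thesis by (simp add: distrib_fun_def *)
  next
    case False
    then have "ennreal u \<le> ennreal s" by (intro ennreal_leI) simp
    then have empty: "?A - ?B = {}" by (auto intro: le_less_trans)
    have "distrib_fun M f s \<le> distrib_fun M f u"
      using False by (intro distrib_fun_antimono) auto
    then show ?thesis using fin
      by (simp only: distrib_fun_def[of _ "lower_cut M f u"] * empty) (simp add: diff_eq_0_ennreal)
  qed
qed

lemma abs_cont_lower_cut:
  assumes "abs_cont K P f"
  shows "(\<lambda>n. P (lower_cut K f (1 / real (Suc n)))) \<longlonglongrightarrow> 0"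
proof -
  have f[measurable]: "f \<in> borel_measurable K" using assms by (simp add: abs_cont_def)
  let ?E = "\<lambda>n. {x \<in> space K. 0 < f x \<and> f x \<le> ennreal (1 / real (Suc n))}"
  have "(\<lambda>n. indicator (?E n) x :: real) \<longlonglongrightarrow> 0" for x
  proof (cases "0 < f x")
    case True
    have "(\<lambda>n. ennreal (1 / real (Suc n))) \<longlonglongrightarrow> 0"
      using tendsto_ennrealI[OF lim_1_over_n[where 'a=real, THEN LIMSEQ_Suc]] by simp
    then have "eventually (\<lambda>n. ennreal (1 / real (Suc n)) < f x) sequentially"
      using True by (rule order_tendstoD)
    then show ?thesis
      by (intro tendsto_eventually) (auto elim!: eventually_mono simp: indicator_def not_le)
  qed auto
  then have "(\<lambda>n. P (\<lambda>x. f x * indicator (?E n) x)) \<longlonglongrightarrow> 0"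
    using assms unfolding abs_cont_def by (auto simp del: of_nat_Suc)
  then show ?thesis by (simp add: lower_cut_def[abs_def])
qed

lemma AE_finite_large_values:
  fixes f :: "'a \<Rightarrow> ennreal"
  assumes "AE x in K. f x < \<infinity>"
  shows "AE x in K. (\<lambda>n. indicator {x \<in> space K. ennreal (real n) < f x} x :: real) \<longlonglongrightarrow> 0"
  using assms
proof eventually_elim
  case (elim x)
  then obtain n where n: "f x < of_nat n" using ennreal_Ex_less_of_nat by auto
  have "eventually (\<lambda>k. indicator {x \<in> space K. ennreal (real k) < f x} x = (0::real)) sequentially"
    unfolding eventually_sequentially
  proof (intro exI allI impI)
    fix k assume "n \<le> k"
    then have "f x \<le> ennreal (real k)"
      using n by (metis ennreal_of_nat_eq_real_of_nat less_imp_le of_nat_mono order.trans)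
    then show "indicator {x \<in> space K. ennreal (real k) < f x} x = (0::real)"
      by (simp add: indicator_def not_less)
  qed
  then show ?case by (rule tendsto_eventually)
qed

lemma abs_cont_upper_cut:
  assumes "abs_cont K P f" "AE x in K. f x < \<infinity>"
  shows "(\<lambda>n. P (upper_cut K f (real n))) \<longlonglongrightarrow> 0"
proof -
  have f[measurable]: "f \<in> borel_measurable K" using assms by (simp add: abs_cont_def)
  let ?E = "\<lambda>n::nat. {x \<in> space K. ennreal (real n) < f x}"
  have "(\<lambda>n. P (\<lambda>x. f x * indicator (?E n) x)) \<longlonglongrightarrow> 0"
    using assms AE_finite_large_values[OF assms(2)] unfolding abs_cont_def
    by auto
  then show ?thesis by (simp add: upper_cut_def[abs_def])
qed

text \<open>The level sets of an almost everywhere finite function shrink to a null set; finiteness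
  of \<open>distrib_fun M f 1\<close> is what lets their measures tend to 0.\<close>

lemma rearr_finite:
  assumes f[measurable]: "f \<in> borel_measurable M" and fin: "distrib_fun M f 1 < \<infinity>"
    and AE: "AE x in M. f x < \<infinity>" and t: "t > 0"
  shows "rearr M f t < \<infinity>"
proof -
  let ?A = "{x \<in> space M. ennreal 1 < f x}"
  have "(\<lambda>n. emeasure M (?A \<inter> {x \<in> space M. ennreal (real n) < f x})) \<longlonglongrightarrow> 0"
    by (rule emeasure_vanishing_sets[OF _ _ _ AE_finite_large_values[OF AE]])
      (use fin in \<open>auto simp: distrib_fun_def\<close>)
  then have "eventually (\<lambda>n. emeasure M (?A \<inter> {x \<in> space M. ennreal (real n) < f x}) < ennreal t) sequentially"
    by (rule order_tendstoD) (use t in simp)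
  then obtain n where n: "emeasure M (?A \<inter> {x \<in> space M. ennreal (real n) < f x}) < ennreal t"
    by (auto simp: eventually_sequentially)
  \<comment> \<open>The maximum with 1 keeps the level set inside \<open>?A\<close>.\<close>
  have "distrib_fun M f (max 1 (real n)) \<le> emeasure M (?A \<inter> {x \<in> space M. ennreal (real n) < f x})"
    unfolding distrib_fun_def by (rule emeasure_mono) (auto intro: le_less_trans[rotated])
  with n have "\<not> ennreal t < distrib_fun M f (max 1 (real n))" by auto
  then have "rearr M f t \<le> ennreal (max 1 (real n))"
    by (subst (asm) less_rearr_iff[OF f, symmetric]) auto
  then show ?thesis by (auto intro: le_less_trans)
qed

text \<open>The only properties of the construction of Xbar that the argument uses outside the case distinction.\<close>
locale rearrangement_representation =
  fixes M :: "'a measure" and N :: "('a \<Rightarrow> ennreal) \<Rightarrow> ennreal"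
    and Nbar :: "(real \<Rightarrow> ennreal) \<Rightarrow> ennreal"
  assumes sigma_finite: "sigma_finite_measure M" and qBFN: "qBFN M N"
    and Nbar_mono: "\<And>p q. p \<in> borel_measurable halfline \<Longrightarrow> q \<in> borel_measurable halfline \<Longrightarrow>
      (\<And>t. 0 \<le> t \<Longrightarrow> rearr halfline p t \<le> rearr halfline q t) \<Longrightarrow> Nbar p \<le> Nbar q"
    and Nbar_rearr: "\<And>g. g \<in> borel_measurable M \<Longrightarrow> Nbar (rearr M g) = N g"
begin

section \<open>Comparison of the two norms, and finiteness of the distribution function\<close>

lemma Nbar_eq_N:
  assumes "p \<in> borel_measurable halfline" "g \<in> borel_measurable M"
    and "\<And>s. 0 \<le> s \<Longrightarrow> distrib_fun halfline p s = distrib_fun M g s"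
  shows "Nbar p = N g"
proof -
  have "rearr halfline p t = rearr halfline (rearr M g) t" for t
    unfolding rearr_rearr[OF assms(2)] by (rule rearr_cong_distrib[OF assms])
  then have "Nbar p = Nbar (rearr M g)"
    using assms by (intro antisym Nbar_mono rearr_measurable_halfline) auto
  then show ?thesis using assms by (simp add: Nbar_rearr)
qed

text \<open>The constant s has a rearrangement of at most s. The bound serves to contradict absolute
  continuity when f_*(s) is infinite.\<close>

lemma N_const_le_Nbar:
  assumes p: "p \<in> borel_measurable halfline" and s: "0 \<le> s"
    and le: "\<And>t. 0 \<le> t \<Longrightarrow> ennreal s \<le> rearr halfline p t"
  shows "N (\<lambda>_. ennreal s) \<le> Nbar p"
proof -
  have "rearr M (\<lambda>_. ennreal s) t \<le> ennreal s" for t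
    unfolding rearr_def using s by (intro Inf_lower) (auto simp: distrib_fun_def)
  then have "Nbar (rearr M (\<lambda>_. ennreal s)) \<le> Nbar p"
    using p by (intro Nbar_mono rearr_measurable_halfline)
      (auto simp: rearr_rearr intro: order.trans[OF _ le])
  then show ?thesis by (simp add: Nbar_rearr)
qed

lemma N_const_pos:
  assumes "emeasure M (space M) \<noteq> 0" "s > 0"
  shows "0 < N (\<lambda>_. ennreal s)"
proof -
  have "N (\<lambda>_. ennreal s) \<noteq> 0"
  proof
    assume "N (\<lambda>_. ennreal s) = 0"
    then have "AE x in M. ennreal s = 0" by (subst (asm) qBFN_eq_0_iff[OF qBFN]) auto
    then have "AE x in M. False" using assms by auto
    then show False using assms by (simp add: AE_iff_measurable[OF sets.top])
  qed
  then show ?thesis by (simp add: zero_less_iff_neq_zero)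
qed

text \<open>If f_*(s) were infinite, removing an exhaustion by sets of finite measure from the set f
  > s would leave sets E_k of infinite measure. Their indicators tend to 0, yet f 1_{E_k} has a
  rearrangement above s everywhere, so its norm cannot tend to 0.\<close>

lemma abs_cont_distrib_finite:
  assumes ac: "abs_cont M N f" and s: "s > 0"
  shows "distrib_fun M f s < \<infinity>"
proof (rule ccontr)
  assume "\<not> distrib_fun M f s < \<infinity>"
  then have inf: "distrib_fun M f s = \<infinity>" by (simp add: less_top[symmetric])
  have f[measurable]: "f \<in> borel_measurable M" using ac by (simp add: abs_cont_def)
  interpret sigma_finite_measure M by (rule sigma_finite)
  obtain A :: "nat \<Rightarrow> 'a set" where A: "range A \<subseteq> sets M" "(\<Union>i. A i) = space M"
    "\<And>i. emeasure M (A i) \<noteq> \<infinity>" "incseq A" using sigma_finite_incseq by blast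
  have [measurable]: "A i \<in> sets M" for i using A by auto
  define E where "E k = {x \<in> space M. ennreal s < f x} - A k" for k
  have [measurable]: "E k \<in> sets M" for k unfolding E_def by measurable
  have "(\<lambda>k. indicator (E k) x :: real) \<longlonglongrightarrow> 0" if x: "x \<in> space M" for x
  proof -
    obtain i where "x \<in> A i" using A(2) x by blast
    then have "eventually (\<lambda>k. x \<in> A k) sequentially"
      unfolding eventually_sequentially using incseqD[OF \<open>incseq A\<close>] by blast
    then show ?thesis
      by (intro tendsto_eventually) (auto elim!: eventually_mono simp: E_def indicator_def)
  qed
  then have lim: "(\<lambda>k. N (\<lambda>x. f x * indicator (E k) x)) \<longlonglongrightarrow> 0"
    using ac unfolding abs_cont_def by auto
  have E_inf: "emeasure M (E k) = \<infinity>" for k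
  proof -
    have "distrib_fun M f s \<le> emeasure M (E k \<union> A k)"
      unfolding distrib_fun_def E_def by (rule emeasure_mono) auto
    also have "\<dots> \<le> emeasure M (E k) + emeasure M (A k)" by (rule emeasure_subadditive) auto
    finally show ?thesis using inf A(3)[of k] by (simp add: top_unique)
  qed
  have "N (\<lambda>_. ennreal s) \<le> N (\<lambda>x. f x * indicator (E k) x)" for k
  proof -
    have "{x \<in> space M. ennreal s < f x * indicator (E k) x} = E k"
      by (auto simp: E_def split: split_indicator_asm)
    then have "ennreal s < rearr M (\<lambda>x. f x * indicator (E k) x) t" for t
      using s by (subst less_rearr_iff) (auto simp: distrib_fun_def E_inf)
    then have "N (\<lambda>_. ennreal s) \<le> Nbar (rearr M (\<lambda>x. f x * indicator (E k) x))"
      using s by (intro N_const_le_Nbar rearr_measurable_halfline)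
        (auto simp: rearr_rearr intro!: less_imp_le)
    then show ?thesis by (simp add: Nbar_rearr)
  qed
  then have "N (\<lambda>_. ennreal s) \<le> 0" by (intro LIMSEQ_le_const[OF lim]) auto
  moreover have "emeasure M (space M) \<noteq> 0"
    using inf emeasure_space[of M "{x \<in> space M. f x > ennreal s}"]
    by (auto simp: distrib_fun_def top_unique)
  ultimately show False using N_const_pos[of s] s by auto
qed

text \<open>If f_*(s) were infinite, f* would exceed s on the whole half-line. Restricted to the
  tails [k, \<infinity>), whose indicators vanish pointwise in the limit, it would still have a
  rearrangement above s everywhere.\<close>

lemma abs_cont_rearr_distrib_finite:
  assumes f: "f \<in> borel_measurable M"
    and ac: "abs_cont halfline Nbar (rearr M f)" and s: "s > 0"
  shows "distrib_fun M f s < \<infinity>"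
proof (rule ccontr)
  assume "\<not> distrib_fun M f s < \<infinity>"
  then have inf: "distrib_fun M f s = \<infinity>" by (simp add: less_top[symmetric])
  have E: "{real k..} \<in> sets halfline" for k by (rule borel_sets_halfline) auto
  have "(\<lambda>k. indicator {real k..} x :: real) \<longlonglongrightarrow> 0" for x
  proof -
    obtain n :: nat where "x < real n" using reals_Archimedean2 by blast
    then have "eventually (\<lambda>k. indicator {real k..} x = (0::real)) sequentially"
      by (auto simp: eventually_sequentially indicator_def intro!: exI[of _ n])
    then show ?thesis by (rule tendsto_eventually)
  qed
  then have lim: "(\<lambda>k. Nbar (\<lambda>x. rearr M f x * indicator {real k..} x)) \<longlonglongrightarrow> 0"
    using ac E unfolding abs_cont_def by auto
  have "N (\<lambda>_. ennreal s) \<le> Nbar (\<lambda>x. rearr M f x * indicator {real k..} x)" for k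
  proof -
    have m: "(\<lambda>x. rearr M f x * indicator {real k..} x) \<in> borel_measurable halfline"
      using rearr_borel_measurable[OF f]
      by (intro borel_measurable_halfline borel_measurable_times_ennreal borel_measurable_indicator) auto
    have "emeasure lborel {real k..} = \<infinity>"
    proof -
      have "emeasure lborel {0::real..} \<le> emeasure lborel ({0..real k} \<union> {real k..})"
        by (rule emeasure_mono) auto
      also have "\<dots> \<le> emeasure lborel {0..real k} + emeasure lborel {real k..}"
        by (rule emeasure_subadditive) auto
      finally show ?thesis
        using emeasure_lborel_ennreal_less_set[of \<infinity>] unfolding ennreal_less_set_eq
        by (auto simp: top_unique)
    qed
    moreover have "{x \<in> space halfline. ennreal s < rearr M f x * indicator {real k..} x} = {real k..}"
      using less_rearr_iff[OF f, of s] s inf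
      by (auto simp: space_restrict_space split: split_indicator_asm split: split_indicator)
    ultimately have "distrib_fun halfline (\<lambda>x. rearr M f x * indicator {real k..} x) s = \<infinity>"
      unfolding distrib_fun_def by (simp add: emeasure_halfline_borel)
    then have "ennreal s < rearr halfline (\<lambda>x. rearr M f x * indicator {real k..} x) t" for t
      using s by (subst less_rearr_iff[OF m]) auto
    then show ?thesis using s by (intro N_const_le_Nbar m) (auto intro!: less_imp_le)
  qed
  then have "N (\<lambda>_. ennreal s) \<le> 0" by (intro LIMSEQ_le_const[OF lim]) auto
  moreover have "emeasure M (space M) \<noteq> 0"
    using inf emeasure_space[of M "{x \<in> space M. f x > ennreal s}"]
    by (auto simp: distrib_fun_def top_unique)
  ultimately show False using N_const_pos[of s] s by auto
qed

text \<open>Here the two hypotheses merge: corresponding cuts of f and of f* have equal norms, so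
  either kind of absolute continuity yields the same limits for \<open>N\<close>.\<close>

lemma abs_cont_cuts:
  assumes f: "f \<in> borel_measurable M" and Nf: "N f < \<infinity>"
    and ac: "abs_cont M N f \<or> abs_cont halfline Nbar (rearr M f)"
  shows "\<And>s. s > 0 \<Longrightarrow> distrib_fun M f s < \<infinity>"
    and "(\<lambda>n. N (lower_cut M f (1 / real (Suc n)))) \<longlonglongrightarrow> 0"
    and "(\<lambda>n. N (upper_cut M f (real n))) \<longlonglongrightarrow> 0"
proof -
  show fin: "\<And>s. s > 0 \<Longrightarrow> distrib_fun M f s < \<infinity>"
    using abs_cont_distrib_finite abs_cont_rearr_distrib_finite f ac by blast
  have f': "rearr M f \<in> borel_measurable halfline" using f by (rule rearr_measurable_halfline)
  have AE: "AE x in M. f x < \<infinity>" by (rule qBFN_finite_AE[of M N f, OF qBFN f Nf])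
  \<comment> \<open>At t = 0 the rearrangement may be infinite, so this null set is
    discarded.\<close>
  have AE': "AE t in halfline. rearr M f t < \<infinity>"
  proof -
    have "AE t in lebesgue. t \<noteq> (0::real)"
      by (rule AE_completion) (rule AE_lborel_singleton)
    then have "AE t in lebesgue. t \<in> {0..} \<longrightarrow> rearr M f t < \<infinity>"
      by eventually_elim (use rearr_finite[OF f fin[of 1] AE] in auto)
    then show ?thesis by (subst AE_restrict_space_iff) auto
  qed
  have low: "Nbar (lower_cut halfline (rearr M f) u) = N (lower_cut M f u)" if "u > 0" for u
    using that fin[of u] f f'
    by (intro Nbar_eq_N) (auto simp: distrib_lower_cut distrib_rearr)
  have up: "Nbar (upper_cut halfline (rearr M f) u) = N (upper_cut M f u)" if "u \<ge> 0" for u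
    using that f f' by (intro Nbar_eq_N) (auto simp: distrib_upper_cut distrib_rearr)
  show "(\<lambda>n. N (lower_cut M f (1 / real (Suc n)))) \<longlonglongrightarrow> 0"
    using ac
  proof
    assume "abs_cont halfline Nbar (rearr M f)"
    from abs_cont_lower_cut[OF this] show ?thesis by (simp add: low)
  qed (rule abs_cont_lower_cut)
  show "(\<lambda>n. N (upper_cut M f (real n))) \<longlonglongrightarrow> 0"
    using ac
  proof
    assume "abs_cont halfline Nbar (rearr M f)"
    from abs_cont_upper_cut[OF this AE'] show ?thesis by (simp add: up)
  qed (rule abs_cont_upper_cut[OF _ AE])
qed

lemma truncation_small:
  assumes f[measurable]: "f \<in> borel_measurable M" and Nf: "N f < \<infinity>"
    and low: "(\<lambda>n. N (lower_cut M f (1 / real (Suc n)))) \<longlonglongrightarrow> 0"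
    and e: "e > 0"
  obtains s :: real where "s > 0" "N (\<lambda>x. min (f x) (ennreal s)) \<le> ennreal e"
proof -
  obtain C :: real where C: "C \<ge> 1"
    and tri: "\<And>f g. f \<in> borel_measurable M \<Longrightarrow> g \<in> borel_measurable M \<Longrightarrow>
      N (\<lambda>x. f x + g x) \<le> ennreal C * (N f + N g)"
    by (rule qBFN_triangle[OF qBFN]) (use that in auto)
  obtain r where r: "N f = ennreal r" "r \<ge> 0" using Nf by (cases "N f") auto
  \<comment> \<open>Each of the two summands receives half of e, divided by the modulus of
    concavity.\<close>
  define d where "d = e / (2 * C)"
  have d: "d > 0" using e C by (simp add: d_def)
  have "eventually (\<lambda>n. N (lower_cut M f (1 / real (Suc n))) < ennreal d) sequentially"
    using low by (rule order_tendstoD) (use d in simp)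
  then obtain n where n: "N (lower_cut M f (1 / real (Suc n))) < ennreal d"
    by (auto simp: eventually_sequentially)
  define u where "u = 1 / real (Suc n)"
  have u: "u > 0" by (simp add: u_def)
  \<comment> \<open>This makes the norm of c f at most d; the added 1 covers
    \<open>N f = 0\<close>.\<close>
  define c where "c = d / (r + 1)"
  have c: "c > 0" "c * r \<le> d" using d r by (auto simp: c_def field_simps)
  \<comment> \<open>The level c u is chosen so that it lies below c f wherever f > u; elsewhere f
    itself is the lower cut.\<close>
  have "N (\<lambda>x. min (f x) (ennreal (c * u))) \<le> N (\<lambda>x. ennreal c * f x + lower_cut M f u x)"
  proof (rule qBFN_mono[OF qBFN])
    fix x assume x: "x \<in> space M"
    consider "f x = 0" | "0 < f x" "f x \<le> ennreal u" | "ennreal u < f x"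
      by (metis not_less zero_less_iff_neq_zero)
    then show "min (f x) (ennreal (c * u)) \<le> ennreal c * f x + lower_cut M f u x"
    proof cases
      case 2
      then have "f x \<le> lower_cut M f u x" using x by (simp add: lower_cut_def)
      then show ?thesis by (intro min.coboundedI1 add_increasing) auto
    next
      case 3
      then have "ennreal (c * u) \<le> ennreal c * f x"
        using c by (simp add: ennreal_mult' mult_left_mono)
      then show ?thesis by (intro min.coboundedI2 add_increasing2) auto
    qed auto
  qed measurable
  also have "\<dots> \<le> ennreal C * (N (\<lambda>x. ennreal c * f x) + N (lower_cut M f u))"
    by (rule tri) measurable
  also have "\<dots> \<le> ennreal C * (ennreal d + ennreal d)"
  proof (intro mult_left_mono add_mono)
    show "N (\<lambda>x. ennreal c * f x) \<le> ennreal d"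
      using c r by (simp add: qBFN_scale[OF qBFN f] ennreal_mult'[symmetric] ennreal_leI)
  qed (use n in \<open>auto simp: u_def\<close>)
  also have "\<dots> = ennreal e"
    using C d by (simp add: d_def ennreal_plus[symmetric] ennreal_mult'[symmetric] del: ennreal_plus)
  finally show thesis using that[of "c * u"] c u by simp
qed

text \<open>The hypothesis \<open>van\<close> is dominated convergence for rearrangements. It stays
  a hypothesis because its proof differs between the two kinds of measure space, while the products
  in both definitions of absolute continuity meet its premises for the same reason.\<close>

lemma abs_cont_of_vanishing_rearr:
  assumes f: "f \<in> borel_measurable M" and Nf: "N f < \<infinity>"
    and fin: "\<And>s. s > 0 \<Longrightarrow> distrib_fun M f s < \<infinity>"
    and van: "\<And>p :: nat \<Rightarrow> real \<Rightarrow> ennreal. (\<And>k. p k \<in> borel_measurable halfline) \<Longrightarrow>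
      (\<And>k t. rearr halfline (p k) t \<le> rearr M f t) \<Longrightarrow>
      (\<And>t. t > 0 \<Longrightarrow> (\<lambda>k. rearr halfline (p k) t) \<longlonglongrightarrow> 0) \<Longrightarrow> (\<lambda>k. Nbar (p k)) \<longlonglongrightarrow> 0"
  shows "abs_cont M N f" "abs_cont halfline Nbar (rearr M f)"
proof -
  note [measurable] = f
  show "abs_cont M N f"
    unfolding abs_cont_def
  proof (intro conjI allI impI)
    fix E :: "nat \<Rightarrow> 'a set"
    assume "\<forall>k. E k \<in> sets M"
      and AE: "AE x in M. (\<lambda>k. indicator (E k) x :: real) \<longlonglongrightarrow> 0"
    then have [measurable]: "E k \<in> sets M" for k by auto
    have "(\<lambda>k. Nbar (rearr M (\<lambda>x. f x * indicator (E k) x))) \<longlonglongrightarrow> 0"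
    proof (rule van)
      fix t :: real assume "t > 0"
      have "(\<lambda>k. rearr M (\<lambda>x. f x * indicator (E k) x) t) \<longlonglongrightarrow> 0"
        by (rule rearr_vanishing_sets) (use AE fin \<open>t > 0\<close> in auto)
      then show "(\<lambda>k. rearr halfline (rearr M (\<lambda>x. f x * indicator (E k) x)) t) \<longlonglongrightarrow> 0"
        by (simp add: rearr_rearr)
    next
      fix k t
      have "rearr M (\<lambda>x. f x * indicator (E k) x) t \<le> rearr M f t"
        by (rule rearr_mono) (auto split: split_indicator)
      then show "rearr halfline (rearr M (\<lambda>x. f x * indicator (E k) x)) t \<le> rearr M f t"
        by (simp add: rearr_rearr)
    qed (intro rearr_measurable_halfline, measurable)
    then show "(\<lambda>k. N (\<lambda>x. f x * indicator (E k) x)) \<longlonglongrightarrow> 0"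
      by (simp add: Nbar_rearr)
  qed (use f Nf in auto)
  show "abs_cont halfline Nbar (rearr M f)"
    unfolding abs_cont_def
  proof (intro conjI allI impI)
    have f'[measurable]: "rearr M f \<in> borel_measurable halfline"
      using f by (rule rearr_measurable_halfline)
    then show "rearr M f \<in> borel_measurable halfline" .
    show "Nbar (rearr M f) < \<infinity>" using f Nf by (simp add: Nbar_rearr)
    fix E :: "nat \<Rightarrow> real set"
    assume "\<forall>k. E k \<in> sets halfline"
      and AE: "AE x in halfline. (\<lambda>k. indicator (E k) x :: real) \<longlonglongrightarrow> 0"
    then have [measurable]: "E k \<in> sets halfline" for k by auto
    show "(\<lambda>k. Nbar (\<lambda>x. rearr M f x * indicator (E k) x)) \<longlonglongrightarrow> 0"
    proof (rule van)
      fix t :: real assume "t > 0"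
      show "(\<lambda>k. rearr halfline (\<lambda>x. rearr M f x * indicator (E k) x) t) \<longlonglongrightarrow> 0"
        by (rule rearr_vanishing_sets) (use AE fin \<open>t > 0\<close> f in \<open>auto simp: distrib_rearr\<close>)
    next
      fix k t
      have "rearr halfline (\<lambda>x. rearr M f x * indicator (E k) x) t \<le> rearr halfline (rearr M f) t"
        by (rule rearr_mono) (auto split: split_indicator)
      then show "rearr halfline (\<lambda>x. rearr M f x * indicator (E k) x) t \<le> rearr M f t"
        using f by (simp add: rearr_rearr)
    qed measurable
  qed
qed

end

section \<open>Equimeasurability, truncations and the interval [0, \<mu>(R))\<close>

lemma rinv_eq_if_distrib_eq:
  assumes "rinv M N" "f \<in> borel_measurable M" "g \<in> borel_measurable M"
    and "\<And>s. 0 \<le> s \<Longrightarrow> distrib_fun M f s = distrib_fun M g s"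
  shows "N f = N g"
proof -
  have "rearr M f t = rearr M g t" for t by (rule rearr_cong_distrib[OF assms(2-4)])
  then show ?thesis using assms(1-3) unfolding rinv_def by blast
qed

lemma distrib_min:
  assumes "0 \<le> s" "0 \<le> c"
  shows "distrib_fun M (\<lambda>x. min (f x) (ennreal c)) s = (if s < c then distrib_fun M f s else 0)"
proof -
  have "{x \<in> space M. ennreal s < min (f x) (ennreal c)}
      = (if s < c then {x \<in> space M. ennreal s < f x} else {})"
    using assms by (auto simp: ennreal_less_iff)
  then show ?thesis by (simp add: distrib_fun_def)
qed

lemma total_interval_borel: "total_interval M \<in> sets borel"
  unfolding total_interval_def by (rule ennreal_less_set_borel)

lemma rearr_eq_0_outside_total_interval:
  assumes "g \<in> borel_measurable M" "0 \<le> t" "t \<notin> total_interval M"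
  shows "rearr M g t = 0"
proof -
  have "distrib_fun M g 0 \<le> emeasure M (space M)"
    unfolding distrib_fun_def by (rule emeasure_space)
  with assms have "\<not> ennreal t < distrib_fun M g 0"
    by (auto simp: total_interval_def not_less intro: order.trans)
  with assms show ?thesis using less_rearr_iff[of g M 0 t] by (simp add: zero_less_iff_neq_zero)
qed

lemma ennreal_nonneg_indicator_le:
  fixes a :: ennreal shows "a * indicator A x \<le> a"
  by (simp split: split_indicator)

section \<open>Non-atomic measure spaces\<close>

locale nonatomic_representation =
  fixes M :: "'a measure" and N :: "('a \<Rightarrow> ennreal) \<Rightarrow> ennreal" and \<sigma> :: "'a \<Rightarrow> real"
  assumes sigma_finite: "sigma_finite_measure M" and qBFN: "qBFN M N" and rinv: "rinv M N"
    and \<sigma>: "measure_preserving M \<sigma>"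
begin

abbreviation "Nb \<equiv> Xbar_of M (Xbar0_nonatomic N \<sigma>)"

lemma \<sigma>_in: "x \<in> space M \<Longrightarrow> \<sigma> x \<in> total_interval M"
  using \<sigma> by (simp add: measure_preserving_def)

lemma \<sigma>_nonneg: "x \<in> space M \<Longrightarrow> 0 \<le> \<sigma> x"
  using \<sigma>_in by (auto simp: total_interval_def)

lemma \<sigma>_preserves:
  assumes "A \<in> sets borel"
  shows "\<sigma> -` A \<inter> space M \<in> sets M"
    and "emeasure M (\<sigma> -` A \<inter> space M) = emeasure lborel (A \<inter> total_interval M)"
proof -
  have eq: "\<sigma> -` A \<inter> space M = \<sigma> -` (A \<inter> total_interval M) \<inter> space M" using \<sigma>_in by auto
  have "A \<inter> total_interval M \<in> sets lborel" using assms total_interval_borel by auto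
  then show "\<sigma> -` A \<inter> space M \<in> sets M"
    and "emeasure M (\<sigma> -` A \<inter> space M) = emeasure lborel (A \<inter> total_interval M)"
    using \<sigma> unfolding eq measure_preserving_def by auto
qed

lemma \<sigma>_measurable [measurable]: "\<sigma> \<in> borel_measurable M"
  by (rule measurableI) (use \<sigma>_preserves in auto)

lemma rearr_\<sigma>_measurable [measurable (raw)]:
  assumes "p \<in> borel_measurable K" shows "(\<lambda>x. rearr K p (\<sigma> x)) \<in> borel_measurable M"
  using rearr_borel_measurable[OF assms] by measurable

text \<open>Since \<sigma> takes values in [0, \<mu>(R)), the truncation in \<open>Xbar_of\<close>
  disappears after composition.\<close>

lemma Nb_eq:
  assumes p: "p \<in> borel_measurable halfline"
  shows "Nb p = N (\<lambda>x. rearr halfline p (\<sigma> x))"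
proof -
  note [measurable] = p total_interval_borel
  have "(\<lambda>t. rearr halfline p t * indicator (total_interval M) t) \<in> borel_measurable borel"
    using rearr_borel_measurable[OF p] by measurable
  from measurable_compose[OF \<sigma>_measurable this]
  show ?thesis
    unfolding Xbar_of_def Xbar0_nonatomic_def comp_def
    by (intro antisym qBFN_mono[OF qBFN] rearr_\<sigma>_measurable p) (auto simp: \<sigma>_in)
qed

text \<open>The level set of a rearrangement is an initial interval, and its preimage under \<sigma>
  has the length of that interval cut off at \<mu>(R).\<close>

lemma distrib_rearr_\<sigma>:
  assumes p: "p \<in> borel_measurable K" and s: "0 \<le> s"
  shows "distrib_fun M (\<lambda>x. rearr K p (\<sigma> x)) s = min (distrib_fun K p s) (emeasure M (space M))"
proof -
  have "{x \<in> space M. ennreal s < rearr K p (\<sigma> x)}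
      = \<sigma> -` {t. 0 \<le> t \<and> ennreal t < distrib_fun K p s} \<inter> space M"
    using less_rearr_iff[OF p s] \<sigma>_nonneg by auto
  then have "distrib_fun M (\<lambda>x. rearr K p (\<sigma> x)) s
      = emeasure lborel ({t. 0 \<le> t \<and> ennreal t < distrib_fun K p s} \<inter> total_interval M)"
    unfolding distrib_fun_def[of M]
    using \<sigma>_preserves(2)[OF ennreal_less_set_borel[of "distrib_fun K p s"]] by (simp only:)
  also have "{t. 0 \<le> t \<and> ennreal t < distrib_fun K p s} \<inter> total_interval M
      = {t. 0 \<le> t \<and> ennreal t < min (distrib_fun K p s) (emeasure M (space M))}"
    by (auto simp: total_interval_def)
  finally show ?thesis by (simp only: emeasure_lborel_ennreal_less_set)
qed

lemma distrib_rearr_\<sigma>_self: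
  assumes "f \<in> borel_measurable M" "0 \<le> s"
  shows "distrib_fun M (\<lambda>x. rearr M f (\<sigma> x)) s = distrib_fun M f s"
  unfolding distrib_rearr_\<sigma>[OF assms]
  by (simp add: distrib_fun_def emeasure_space min_absorb1)

sublocale rearrangement_representation M N Nb
proof (rule rearrangement_representation.intro)
  fix p q assume p: "p \<in> borel_measurable halfline" and q: "q \<in> borel_measurable halfline"
    and le: "\<And>t. 0 \<le> t \<Longrightarrow> rearr halfline p t \<le> rearr halfline q t"
  show "Nb p \<le> Nb q"
    unfolding Nb_eq[OF p] Nb_eq[OF q]
    by (intro qBFN_mono[OF qBFN] rearr_\<sigma>_measurable p q le \<sigma>_nonneg)
next
  fix g :: "'a \<Rightarrow> ennreal" assume g: "g \<in> borel_measurable M"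
  show "Nb (rearr M g) = N g"
    unfolding Nb_eq[OF rearr_measurable_halfline[OF g]] rearr_rearr[OF g]
    by (intro rinv_eq_if_distrib_eq[OF rinv] rearr_\<sigma>_measurable distrib_rearr_\<sigma>_self g)
qed (fact sigma_finite qBFN)+

text \<open>If all sets q > s with s < c have measure at least \<delta>, then q* is at least c on
  [0, \<delta>), and monotonicity of the norm applies.\<close>

lemma N_initial_segment_le:
  assumes q: "q \<in> borel_measurable halfline" and c: "0 \<le> c"
    and le: "\<And>s. 0 \<le> s \<Longrightarrow> s < c \<Longrightarrow> ennreal \<delta> \<le> distrib_fun halfline q s"
  shows "ennreal c * N (\<lambda>x. indicator {..<\<delta>} (\<sigma> x)) \<le> Nb q"
proof -
  have "ennreal c * N (\<lambda>x. indicator {..<\<delta>} (\<sigma> x)) = N (\<lambda>x. ennreal c * indicator {..<\<delta>} (\<sigma> x))"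
    using c by (intro qBFN_scale[OF qBFN, symmetric]) auto
  also have "\<dots> \<le> N (\<lambda>x. rearr halfline q (\<sigma> x))"
  proof (rule qBFN_mono[OF qBFN])
    fix x assume x: "x \<in> space M"
    show "ennreal c * indicator {..<\<delta>} (\<sigma> x) \<le> rearr halfline q (\<sigma> x)"
    proof (cases "\<sigma> x < \<delta>")
      case True
      have "ennreal c \<le> rearr halfline q (\<sigma> x)"
      proof (rule ennreal_le_if_less)
        fix s :: real assume s: "0 \<le> s" "ennreal s < ennreal c"
        then have "s < c" by (simp add: ennreal_less_iff)
        have "ennreal (\<sigma> x) < ennreal \<delta>" using True \<sigma>_nonneg[OF x] by (simp add: ennreal_less_iff)
        also have "\<dots> \<le> distrib_fun halfline q s" using s \<open>s < c\<close> by (intro le)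
        finally show "ennreal s < rearr halfline q (\<sigma> x)" using less_rearr_iff[OF q s(1)] by simp
      qed
      with True show ?thesis by simp
    qed simp
  qed (use q in \<open>measurable\<close>)
  also have "\<dots> = Nb q" by (rule Nb_eq[OF q, symmetric])
  finally show ?thesis .
qed

text \<open>Preimages of dyadic intervals of length 2^-n slice A into countably many sets of measure
  at most 2^-n, not all of them null. One non-null slice for each n gives summable measures, and
  Borel-Cantelli yields the convergence.\<close>

lemma positive_subsets_vanishing:
  assumes A[measurable]: "A \<in> sets M" and pos: "emeasure M A \<noteq> 0"
  obtains B :: "nat \<Rightarrow> 'a set" where
    "\<And>n. B n \<in> sets M" "\<And>n. B n \<subseteq> A" "\<And>n. 0 < measure M (B n)"
    "\<And>n. emeasure M (B n) = ennreal (measure M (B n))"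
    "AE x in M. (\<lambda>n. indicator (B n) x :: real) \<longlonglongrightarrow> 0"
proof -
  define I :: "nat \<Rightarrow> nat \<Rightarrow> real set" where "I n j = {real j * (1/2)^n ..< (real j + 1) * (1/2)^n}" for n j
  define D where "D n j = A \<inter> (\<sigma> -` I n j \<inter> space M)" for n j
  have [measurable]: "I n j \<in> sets borel" for n j by (simp add: I_def)
  have D[measurable]: "D n j \<in> sets M" for n j
    unfolding D_def using \<sigma>_preserves(1)[of "I n j"] by auto
  have le: "emeasure M (D n j) \<le> ennreal ((1/2)^n)" for n j
  proof -
    have "emeasure M (D n j) \<le> emeasure M (\<sigma> -` I n j \<inter> space M)"
      unfolding D_def by (rule emeasure_mono) (auto simp: \<sigma>_preserves)
    also have "\<dots> \<le> emeasure lborel (I n j)"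
      by (subst \<sigma>_preserves) (auto intro!: emeasure_mono)
    also have "\<dots> = ennreal ((1/2)^n)"
      unfolding I_def by (subst emeasure_lborel_Ico) (auto simp: algebra_simps)
    finally show ?thesis .
  qed
  have "\<exists>j. emeasure M (D n j) \<noteq> 0" for n
  proof (rule ccontr)
    assume "\<nexists>j. emeasure M (D n j) \<noteq> 0"
    then have "(\<Union>j. D n j) \<in> null_sets M" by (intro null_sets_UN) auto
    moreover have "(\<Union>j. D n j) = A"
    proof safe
      fix x assume x: "x \<in> A"
      then have x': "x \<in> space M" using sets.sets_into_space[OF A] by auto
      \<comment> \<open>The integer part of y is the index of the slice containing x.\<close>
      define y where "y = \<sigma> x * 2 ^ n"
      have y: "0 \<le> y" using \<sigma>_nonneg[OF x'] by (simp add: y_def)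
      have "real (nat \<lfloor>y\<rfloor>) \<le> y" "y < real (nat \<lfloor>y\<rfloor>) + 1" using y by linarith+
      then have "\<sigma> x \<in> I n (nat \<lfloor>y\<rfloor>)" by (simp add: I_def y_def field_simps power_divide)
      then show "x \<in> (\<Union>j. D n j)" using x x' by (auto simp: D_def)
    qed (auto simp: D_def)
    ultimately show False using pos by auto
  qed
  then obtain j where j: "\<And>n. emeasure M (D n (j n)) \<noteq> 0" by metis
  define B where "B n = D n (j n)" for n
  have [measurable]: "B n \<in> sets M" for n by (simp add: B_def)
  have fin: "emeasure M (B n) < \<infinity>" for n
    unfolding B_def by (rule le_less_trans[OF le]) simp
  then have eq: "emeasure M (B n) = ennreal (measure M (B n))" for n
    by (simp add: emeasure_eq_ennreal_measure less_top[symmetric])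
  have mle: "measure M (B n) \<le> (1/2)^n" for n
    using le[of n "j n"] eq[of n] by (simp add: B_def)
  have pos': "0 < measure M (B n)" for n
    using j[of n] eq[of n] by (auto simp: B_def zero_less_measure_iff)
  have "summable (\<lambda>n. measure M (B n))"
    by (rule summable_comparison_test'[of "\<lambda>n. (1/2)^n" 0]) (use mle in auto)
  then have "AE x in M. eventually (\<lambda>n. x \<in> space M - B n) sequentially"
    by (intro borel_cantelli_AE1 fin) auto
  then have "AE x in M. (\<lambda>n. indicator (B n) x :: real) \<longlonglongrightarrow> 0"
    by eventually_elim (auto intro!: tendsto_eventually elim!: eventually_mono)
  moreover have "B n \<subseteq> A" for n by (auto simp: B_def D_def)
  ultimately show thesis using that[of B] pos' eq by auto
qed

text \<open>A non-zero f exceeds some c > 0 on a set of positive measure. Pieces of f or of f* over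
  shrinking sets have norms tending to 0, and their rearrangements lie above c on initial
  segments.\<close>

lemma N_initial_segment_small:
  assumes f[measurable]: "f \<in> borel_measurable M"
    and nz: "\<not> (AE x in M. f x = 0)"
    and ac: "abs_cont M N f \<or> abs_cont halfline Nb (rearr M f)" and e: "e > 0"
  obtains \<delta> where "\<delta> > 0" "N (\<lambda>x. indicator {..<\<delta>} (\<sigma> x)) \<le> ennreal e"
proof -
  have "\<not> {x \<in> space M. \<not> f x = 0} \<in> null_sets M"
    using nz AE_iff_null_sets[of "{x \<in> space M. \<not> f x = 0}" M] by (auto elim!: AE_mp)
  then have "ennreal 0 < distrib_fun M f 0"
    by (auto simp: distrib_fun_def null_sets_def zero_less_iff_neq_zero)
  then have "0 < rearr M f 0" using less_rearr_iff[OF f, of 0 0] by simp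
  \<comment> \<open>A level strictly below f*(0) is taken because f*(0) may be infinite.\<close>
  then obtain c' where c': "0 < c'" "c' < rearr M f 0" using dense by blast
  then obtain c where c: "0 < c" "c' = ennreal c" by (cases c') auto
  then have dpos: "0 < distrib_fun M f c" using c' less_rearr_iff[OF f, of c 0] by simp
  \<comment> \<open>The common form of both hypotheses: the norms of q_n tend to 0 while its level
    sets below c keep measure at least \<delta>_n.\<close>
  have "\<exists>q \<delta>. (\<forall>n. q n \<in> borel_measurable halfline \<and> 0 < \<delta> n \<and>
      (\<forall>s. 0 \<le> s \<longrightarrow> s < c \<longrightarrow> ennreal (\<delta> n) \<le> distrib_fun halfline (q n) s)) \<and> (\<lambda>n::nat. Nb (q n)) \<longlonglongrightarrow> 0"
    using ac
  proof
    assume ac: "abs_cont M N f"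
    have "emeasure M {x \<in> space M. ennreal c < f x} \<noteq> 0"
      using dpos by (auto simp: distrib_fun_def)
    then obtain B where B[measurable]: "\<And>n. B n \<in> sets M"
      and sub: "\<And>n. B n \<subseteq> {x \<in> space M. ennreal c < f x}"
      and pos: "\<And>n. 0 < measure M (B n)"
      and eq: "\<And>n. emeasure M (B n) = ennreal (measure M (B n))"
      and AE: "AE x in M. (\<lambda>n. indicator (B n) x :: real) \<longlonglongrightarrow> 0"
      using positive_subsets_vanishing[of "{x \<in> space M. ennreal c < f x}"] by auto
    let ?g = "\<lambda>n x. f x * indicator (B n) x"
    have "(\<lambda>n. N (?g n)) \<longlonglongrightarrow> 0" using ac B AE unfolding abs_cont_def by auto
    then have "(\<lambda>n. Nb (rearr M (?g n))) \<longlonglongrightarrow> 0" by (simp add: Nbar_rearr)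
    moreover have "ennreal (measure M (B n)) \<le> distrib_fun halfline (rearr M (?g n)) s"
      if s: "0 \<le> s" "s < c" for n s
    proof -
      have "emeasure M (B n) \<le> distrib_fun M (?g n) s"
        unfolding distrib_fun_def using sub[of n] order.strict_trans1[OF ennreal_leI[of s c]] s
        by (intro emeasure_mono) (auto simp: subset_eq)
      then show ?thesis using s by (simp add: distrib_rearr eq)
    qed
    moreover have "rearr M (?g n) \<in> borel_measurable halfline" for n
      by (rule rearr_measurable_halfline) measurable
    ultimately show ?thesis
      using pos by (intro exI[of _ "\<lambda>n. rearr M (?g n)"] exI[of _ "\<lambda>n. measure M (B n)"]) blast
  next
    assume ac: "abs_cont halfline Nb (rearr M f)"
    \<comment> \<open>A finite length below the possibly infinite f_*(c); on [0, d) the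
      rearrangement f* exceeds every s < c.\<close>
    obtain d' where d': "0 < d'" "d' < distrib_fun M f c" using dpos dense by blast
    then obtain d where d: "0 < d" "d' = ennreal d" by (cases d') auto
    \<comment> \<open>Leaving out 0 makes the indicators tend to 0 at every point.\<close>
    define E where "E n = {0<..<1 / real (Suc n)}" for n
    have E: "E n \<in> sets halfline" for n by (rule borel_sets_halfline) (auto simp: E_def)
    have "(\<lambda>n. indicator (E n) x :: real) \<longlonglongrightarrow> 0" for x
    proof (cases "0 < x")
      case True
      have "eventually (\<lambda>n. 1 / real (Suc n) < x) sequentially"
        using lim_1_over_n[where 'a=real, THEN LIMSEQ_Suc] True by (rule order_tendstoD)
      then show ?thesis
        by (intro tendsto_eventually) (auto elim!: eventually_mono simp: indicator_def E_def)
    qed (simp add: E_def)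
    then have "(\<lambda>n. Nb (\<lambda>x. rearr M f x * indicator (E n) x)) \<longlonglongrightarrow> 0"
      using ac E unfolding abs_cont_def by auto
    moreover have "(\<lambda>x. rearr M f x * indicator (E n) x) \<in> borel_measurable halfline" for n
      using rearr_measurable_halfline[OF f] E[of n] by measurable
    moreover have "0 < min d (1 / real (Suc n))" for n using d by simp
    moreover have "ennreal (min d (1 / real (Suc n)))
        \<le> distrib_fun halfline (\<lambda>x. rearr M f x * indicator (E n) x) s" if s: "0 \<le> s" "s < c" for n s
    proof -
      let ?m = "min d (1 / real (Suc n))"
      have m: "0 < ?m" using d by simp
      have "ennreal ?m = emeasure halfline {0<..<?m}"
        using m by (subst emeasure_halfline_borel) auto
      also have "\<dots> \<le> distrib_fun halfline (\<lambda>x. rearr M f x * indicator (E n) x) s"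
        unfolding distrib_fun_def
      proof (rule emeasure_mono)
        have m': "(\<lambda>x. rearr M f x * indicator (E n) x) \<in> borel_measurable halfline"
          using rearr_measurable_halfline[OF f] E[of n] by measurable
        then show "{x \<in> space halfline. ennreal s < rearr M f x * indicator (E n) x} \<in> sets halfline"
          by measurable
        show "{0<..<?m} \<subseteq> {x \<in> space halfline. ennreal s < rearr M f x * indicator (E n) x}"
        proof
          fix t assume t: "t \<in> {0<..<?m}"
          then have "ennreal t < ennreal d" by (simp add: ennreal_less_iff)
          also have "\<dots> \<le> distrib_fun M f s"
            using d' d distrib_fun_antimono[OF f, of s c] s by auto
          finally have "ennreal s < rearr M f t" using less_rearr_iff[OF f s(1)] by simp
          then show "t \<in> {x \<in> space halfline. ennreal s < rearr M f x * indicator (E n) x}"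
            using t by (auto simp: E_def space_restrict_space)
        qed
      qed
      finally show ?thesis .
    qed
    ultimately show ?thesis
      by (intro exI[of _ "\<lambda>n x. rearr M f x * indicator (E n) x"]
          exI[of _ "\<lambda>n. min d (1 / real (Suc n))"]) blast
  qed
  then obtain q \<delta> where q: "\<And>n::nat. q n \<in> borel_measurable halfline" and \<delta>: "\<And>n. 0 < \<delta> n"
    and le: "\<And>n s. 0 \<le> s \<Longrightarrow> s < c \<Longrightarrow> ennreal (\<delta> n) \<le> distrib_fun halfline (q n) s"
    and lim: "(\<lambda>n. Nb (q n)) \<longlonglongrightarrow> 0" by blast
  have "eventually (\<lambda>n. Nb (q n) < ennreal (c * e)) sequentially"
    using lim by (rule order_tendstoD) (use c e in simp)
  then obtain n where "Nb (q n) < ennreal (c * e)" by (auto simp: eventually_sequentially)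
  with N_initial_segment_le[OF q, of c "\<delta> n" n] le c
  have "ennreal c * N (\<lambda>x. indicator {..<\<delta> n} (\<sigma> x)) \<le> ennreal c * ennreal e"
    by (auto simp: ennreal_mult' intro: order.trans less_imp_le)
  then have "N (\<lambda>x. indicator {..<\<delta> n} (\<sigma> x)) \<le> ennreal e"
    using c by (subst (asm) ennreal_mult_le_mult_iff) auto
  then show thesis using \<delta> that by blast
qed

lemma Nb_vanishing_rearr:
  assumes f[measurable]: "f \<in> borel_measurable M" and Nf: "N f < \<infinity>"
    and ac: "abs_cont M N f \<or> abs_cont halfline Nb (rearr M f)"
    and p: "\<And>k::nat. p k \<in> borel_measurable halfline"
    and le: "\<And>k t. rearr halfline (p k) t \<le> rearr M f t"
    and lim: "\<And>t. t > 0 \<Longrightarrow> (\<lambda>k. rearr halfline (p k) t) \<longlonglongrightarrow> 0"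
  shows "(\<lambda>k. Nb (p k)) \<longlonglongrightarrow> 0"
proof (cases "AE x in M. f x = 0")
  \<comment> \<open>Absolute continuity of the zero function says nothing about initial segments, so
    this case rests on monotonicity alone.\<close>
  case True
  then have "N f = 0" using qBFN_eq_0_iff[OF qBFN f] by simp
  moreover have "Nb (p k) \<le> Nb (rearr M f)" for k
    using le by (intro Nbar_mono p rearr_measurable_halfline f) (simp add: rearr_rearr f)
  ultimately have "Nb (p k) = 0" for k using Nbar_rearr[OF f] by (metis le_zero_eq)
  then show ?thesis by simp
next
  case False
  note cuts = abs_cont_cuts[OF f Nf ac]
  obtain C :: real where C: "C \<ge> 1"
    and tri: "\<And>f g. f \<in> borel_measurable M \<Longrightarrow> g \<in> borel_measurable M \<Longrightarrow>
      N (\<lambda>x. f x + g x) \<le> ennreal C * (N f + N g)"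
    by (rule qBFN_triangle[OF qBFN]) (use that in auto)
  \<comment> \<open>This g has the distribution of f, but unlike f it can be compared pointwise with
    h_k composed with \<sigma>.\<close>
  define g where "g x = rearr M f (\<sigma> x)" for x
  have g[measurable]: "g \<in> borel_measurable M" unfolding g_def by measurable
  have dg: "distrib_fun M g s = distrib_fun M f s" if "0 \<le> s" for s
    unfolding g_def using f that by (rule distrib_rearr_\<sigma>_self)
  show ?thesis
  \<comment> \<open>Three summands of norm at most e, joined by two quasi-triangle inequalities,
    give C (e + C (e + e)).\<close>
  proof (rule tendsto_0_ennrealI[where D = "C * (1 + C * 2)"])
    fix e :: real assume e: "e > 0"
    have "eventually (\<lambda>n. N (upper_cut M f (real n)) < ennreal e) sequentially"
      using cuts(3) by (rule order_tendstoD) (use e in simp)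
    then obtain n where n: "N (upper_cut M f (real n)) < ennreal e"
      by (auto simp: eventually_sequentially)
    define S where "S = real n"
    have S: "S \<ge> 0" by (simp add: S_def)
    have "N (upper_cut M g S) = N (upper_cut M f S)"
      by (rule rinv_eq_if_distrib_eq[OF rinv]) (use S in \<open>auto simp: distrib_upper_cut dg\<close>)
    then have 1: "N (upper_cut M g S) \<le> ennreal e" using n by (simp add: S_def)
    \<comment> \<open>The segment will be multiplied by S; the added 1 covers S = 0.\<close>
    obtain \<delta> where \<delta>: "\<delta> > 0" and "N (\<lambda>x. indicator {..<\<delta>} (\<sigma> x)) \<le> ennreal (e / (S + 1))"
      using N_initial_segment_small[OF f False ac, of "e / (S + 1)"] e S by auto
    then have "N (\<lambda>x. ennreal S * indicator {..<\<delta>} (\<sigma> x)) \<le> ennreal S * ennreal (e / (S + 1))"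
      using S by (subst qBFN_scale[OF qBFN]) (auto intro: mult_left_mono)
    also have "\<dots> \<le> ennreal e"
      using S e by (subst ennreal_mult'[symmetric]) (auto intro!: ennreal_leI simp: field_simps)
    finally have 2: "N (\<lambda>x. ennreal S * indicator {..<\<delta>} (\<sigma> x)) \<le> ennreal e" .
    obtain s where s: "s > 0" and "N (\<lambda>x. min (f x) (ennreal s)) \<le> ennreal e"
      using truncation_small[OF f Nf cuts(2) e] by auto
    moreover have "N (\<lambda>x. min (g x) (ennreal s)) = N (\<lambda>x. min (f x) (ennreal s))"
      by (rule rinv_eq_if_distrib_eq[OF rinv]) (use s in \<open>auto simp: distrib_min dg\<close>)
    ultimately have 3: "N (\<lambda>x. min (g x) (ennreal s)) \<le> ennreal e" by simp
    \<comment> \<open>One point suffices: to the right of \<delta> the decreasing h_k stays below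
      its value at \<delta>.\<close>
    have "eventually (\<lambda>k. rearr halfline (p k) \<delta> < ennreal s) sequentially"
      using lim[OF \<delta>] by (rule order_tendstoD) (use s in simp)
    then show "eventually (\<lambda>k. Nb (p k) \<le> ennreal (C * (1 + C * 2) * e)) sequentially"
    proof eventually_elim
      case (elim k)
      let ?b = "\<lambda>x. ennreal S * indicator {..<\<delta>} (\<sigma> x) :: ennreal"
      let ?c = "\<lambda>x. min (g x) (ennreal s)"
      have "Nb (p k) = N (\<lambda>x. rearr halfline (p k) (\<sigma> x))" by (rule Nb_eq[OF p])
      also have "\<dots> \<le> N (\<lambda>x. upper_cut M g S x + (?b x + ?c x))"
      proof (rule qBFN_mono[OF qBFN])
        fix x assume x: "x \<in> space M"
        have le': "rearr halfline (p k) (\<sigma> x) \<le> g x" using le by (simp add: g_def)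
        consider "ennreal S < g x" | "g x \<le> ennreal S" "\<sigma> x < \<delta>" | "\<delta> \<le> \<sigma> x" by force
        then show "rearr halfline (p k) (\<sigma> x) \<le> upper_cut M g S x + (?b x + ?c x)"
        proof cases
          case 1
          then have "upper_cut M g S x = g x" using x by (simp add: upper_cut_def)
          then show ?thesis using le' by (simp add: add_increasing2)
        next
          case 2
          then have "rearr halfline (p k) (\<sigma> x) \<le> ?b x" using le' by simp
          then show ?thesis by (intro add_increasing add_increasing2) auto
        next
          case 3
          have "rearr halfline (p k) (\<sigma> x) \<le> rearr halfline (p k) \<delta>"
            using p 3 by (rule rearr_antimono)
          then have "rearr halfline (p k) (\<sigma> x) \<le> ?c x" using elim le' by simp
          then show ?thesis by (intro add_increasing) auto
        qed
      qed (use p in measurable)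
      also have "\<dots> \<le> ennreal C * (N (upper_cut M g S) + N (\<lambda>x. ?b x + ?c x))"
        by (rule tri) measurable
      also have "\<dots> \<le> ennreal C * (ennreal e + ennreal C * (ennreal e + ennreal e))"
      proof (intro mult_left_mono add_mono 1)
        have "N (\<lambda>x. ?b x + ?c x) \<le> ennreal C * (N ?b + N ?c)" by (rule tri) measurable
        also have "\<dots> \<le> ennreal C * (ennreal e + ennreal e)"
          by (intro mult_left_mono add_mono 2 3) simp
        finally show "N (\<lambda>x. ?b x + ?c x) \<le> ennreal C * (ennreal e + ennreal e)" .
      qed simp
      also have "\<dots> = ennreal (C * (1 + C * 2) * e)"
        using C e by (simp add: ennreal_plus[symmetric] ennreal_mult'[symmetric] algebra_simps
            del: ennreal_plus)
      finally show ?case .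
    qed
  qed (use C in \<open>auto intro!: mult_pos_pos add_pos_nonneg\<close>)
qed

end

section \<open>Completely atomic measure spaces\<close>

locale atomic_representation =
  fixes M :: "'a measure" and N :: "('a \<Rightarrow> ennreal) \<Rightarrow> ennreal" and \<beta> :: real and e :: "nat \<Rightarrow> 'a set"
  assumes sigma_finite: "sigma_finite_measure M" and qBFN: "qBFN M N" and rinv: "rinv M N"
    and \<beta>: "0 < \<beta>"
    and atoms: "\<And>n. n \<in> atom_index M \<beta> \<Longrightarrow> atom M (e n) \<and> emeasure M (e n) = ennreal \<beta>"
    and disj: "disjoint_family_on e (atom_index M \<beta>)"
    and cover: "(\<Union>n \<in> atom_index M \<beta>. e n) = space M"
begin

abbreviation "Nb \<equiv> Xbar_of M (Xbar0_atomic M N \<beta> e)"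

definition block :: "nat \<Rightarrow> real set" where
  "block n = {\<beta> * real n ..< \<beta> * real (Suc n)}"

definition avg :: "nat \<Rightarrow> (real \<Rightarrow> ennreal) \<Rightarrow> ennreal" where
  "avg n r = (\<integral>\<^sup>+ t. r t * indicator (block n) t \<partial>lborel) / ennreal \<beta>"

text \<open>The construction rearranges twice: \<open>Xbar_of\<close> rearranges and truncates, then
  \<open>T_op\<close> rearranges the result again.\<close>

abbreviation prof :: "(real \<Rightarrow> ennreal) \<Rightarrow> real \<Rightarrow> ennreal" where
  "prof p \<equiv> rearr halfline (\<lambda>t. rearr halfline p t * indicator (total_interval M) t)"

abbreviation lift :: "(real \<Rightarrow> ennreal) \<Rightarrow> 'a \<Rightarrow> ennreal" where
  "lift p \<equiv> T_op M \<beta> e (\<lambda>t. rearr halfline p t * indicator (total_interval M) t)"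

section \<open>Values of the averaging operator on atoms, and the effect of truncation\<close>

lemma e_sets [measurable]: "n \<in> atom_index M \<beta> \<Longrightarrow> e n \<in> sets M"
  using atoms by (auto simp: atom_def)

lemma obtain_atom:
  assumes "x \<in> space M"
  obtains n where "n \<in> atom_index M \<beta>" "x \<in> e n"
  using assms cover by auto

lemma T_op_eq:
  assumes n: "n \<in> atom_index M \<beta>" and x: "x \<in> e n"
  shows "T_op M \<beta> e h x = avg n (rearr halfline h)"
proof -
  have "x \<notin> e m" if "m \<in> atom_index M \<beta>" "m \<noteq> n" for m
    using that n x disj by (auto simp: disjoint_family_on_def)
  then show ?thesis
    unfolding T_op_def
    by (subst suminf_finite[of "{n}"]) (use n x in \<open>auto simp: avg_def block_def\<close>)
qed

lemma T_op_measurable [measurable]: "T_op M \<beta> e h \<in> borel_measurable M"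
proof -
  have "(\<lambda>x. if n \<in> atom_index M \<beta> then indicator (e n) x * c else 0) \<in> borel_measurable M"
    for n and c :: ennreal
    by (cases "n \<in> atom_index M \<beta>") auto
  then show ?thesis unfolding T_op_def[abs_def] by (intro borel_measurable_suminf_order)
qed

lemma Nb_eq: "Nb p = N (lift p)"
  by (simp add: Xbar_of_def Xbar0_atomic_def)

lemma prof_fun_measurable:
  assumes "p \<in> borel_measurable halfline"
  shows "(\<lambda>t. rearr halfline p t * indicator (total_interval M) t) \<in> borel_measurable halfline"
proof -
  show ?thesis
    using rearr_borel_measurable[OF assms] total_interval_borel[of M]
    by (intro borel_measurable_halfline borel_measurable_times_ennreal borel_measurable_indicator) auto
qed

lemma prof_mono:
  assumes "p \<in> borel_measurable halfline" "q \<in> borel_measurable halfline"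
    and "\<And>t. 0 \<le> t \<Longrightarrow> rearr halfline p t \<le> rearr halfline q t"
  shows "prof p t \<le> prof q t"
  by (intro rearr_mono prof_fun_measurable assms mult_right_mono) (auto simp: space_restrict_space)

lemma prof_le:
  assumes "p \<in> borel_measurable halfline"
  shows "prof p t \<le> rearr halfline p t"
proof -
  have "prof p t \<le> rearr halfline (rearr halfline p) t"
    by (intro rearr_mono prof_fun_measurable rearr_measurable_halfline assms
        ennreal_nonneg_indicator_le)
  then show ?thesis by (simp add: rearr_rearr assms)
qed

text \<open>As g* vanishes from \<mu>(R) on, truncation loses nothing, and the second rearrangement
  leaves a rearranged function unchanged.\<close>

lemma prof_rearr:
  assumes g: "g \<in> borel_measurable M"
  shows "prof (rearr M g) t = rearr M g t"
proof -
  have "rearr M g t * indicator (total_interval M) t = rearr M g t" if "0 \<le> t" for t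
    using rearr_eq_0_outside_total_interval[OF g that] by (auto split: split_indicator)
  moreover have "(\<lambda>t. rearr M g t * indicator (total_interval M) t) \<in> borel_measurable halfline"
    using prof_fun_measurable[OF rearr_measurable_halfline[OF g]] by (simp add: rearr_rearr g)
  ultimately have "rearr halfline (\<lambda>t. rearr M g t * indicator (total_interval M) t) t
      = rearr halfline (rearr M g) t"
    using rearr_measurable_halfline[OF g]
    by (intro antisym rearr_mono) (auto simp: space_restrict_space)
  then show ?thesis by (simp add: rearr_rearr g)
qed

section \<open>Averages over blocks\<close>

lemma avg_mono: "(\<And>t. r t \<le> r' t) \<Longrightarrow> avg n r \<le> avg n r'"
  unfolding avg_def by (intro divide_right_mono_ennreal nn_integral_mono mult_right_mono) auto

lemma block_measure: "emeasure lborel (block n) = ennreal \<beta>"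
  unfolding block_def using \<beta> by (subst emeasure_lborel_Ico) (auto simp: algebra_simps)

lemma block_sets [measurable]: "block n \<in> sets borel"
  by (simp add: block_def)

lemma avg_const_on_block:
  assumes "\<And>t. t \<in> block n \<Longrightarrow> r t = c"
  shows "avg n r = c"
proof -
  have "(\<integral>\<^sup>+ t. r t * indicator (block n) t \<partial>lborel) = (\<integral>\<^sup>+ t. c * indicator (block n) t \<partial>lborel)"
    by (intro nn_integral_cong) (use assms in \<open>auto split: split_indicator\<close>)
  also have "\<dots> = c * ennreal \<beta>"
    by (subst nn_integral_cmult_indicator) (auto simp: block_measure)
  finally show ?thesis
    unfolding avg_def using \<beta> by (simp add: ennreal_times_divide[symmetric] divide_self_if mult_divide_eq_ennreal)
qed

text \<open>Both averages are compared with the constant r(\<beta>): block 0 lies to the left of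
  \<beta>, every later block to its right.\<close>

lemma avg_le_avg_0:
  assumes "\<And>t t'. t \<le> t' \<Longrightarrow> r t' \<le> r t"
  shows "avg n r \<le> avg 0 r"
proof (cases n)
  case (Suc m)
  let ?c = "\<lambda>_. r \<beta>"
  have "avg n r \<le> avg n ?c"
  proof -
    have "\<beta> \<le> t" if "t \<in> block n" for t
    proof -
      have "\<beta> * 1 \<le> \<beta> * real n" using \<beta> Suc by (intro mult_left_mono) auto
      with that show ?thesis by (simp add: block_def)
    qed
    then show ?thesis
      unfolding avg_def using assms
      by (intro divide_right_mono_ennreal nn_integral_mono) (auto split: split_indicator)
  qed
  also have "\<dots> = r \<beta>" by (rule avg_const_on_block) simp
  also have "\<dots> = avg 0 ?c" by (rule avg_const_on_block[symmetric]) simp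
  also have "\<dots> \<le> avg 0 r"
    unfolding avg_def using assms
    by (intro divide_right_mono_ennreal nn_integral_mono) (auto simp: block_def split: split_indicator)
  finally show ?thesis .
qed simp

text \<open>Each atom meets A in measure 0 or in full measure, so by countable additivity only the
  number of fully met atoms matters.\<close>

lemma emeasure_atomic:
  assumes A[measurable]: "A \<in> sets M"
  shows "emeasure M A
    = ennreal \<beta> * emeasure (count_space (atom_index M \<beta>)) {n \<in> atom_index M \<beta>. emeasure M (A \<inter> e n) = ennreal \<beta>}"
proof -
  let ?P = "{n \<in> atom_index M \<beta>. emeasure M (A \<inter> e n) = ennreal \<beta>}"
  have "A = (\<Union>n\<in>atom_index M \<beta>. A \<inter> e n)"
    using sets.sets_into_space[OF A] cover by auto
  then have "emeasure M A = emeasure M (\<Union>n\<in>atom_index M \<beta>. A \<inter> e n)" by simp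
  also have "\<dots> = (\<integral>\<^sup>+ n. emeasure M (A \<inter> e n) \<partial>count_space (atom_index M \<beta>))"
    using disj by (intro emeasure_UN_countable) (auto simp: disjoint_family_on_def)
  also have "\<dots> = (\<integral>\<^sup>+ n. ennreal \<beta> * indicator ?P n \<partial>count_space (atom_index M \<beta>))"
  proof (rule nn_integral_cong)
    fix n assume "n \<in> space (count_space (atom_index M \<beta>))"
    then have n: "n \<in> atom_index M \<beta>" by simp
    then have "A \<inter> e n \<in> sets M" by auto
    then have "emeasure M (A \<inter> e n) = 0 \<or> emeasure M (A \<inter> e n) = ennreal \<beta>"
      using atoms[OF n] unfolding atom_def by auto
    then show "emeasure M (A \<inter> e n) = ennreal \<beta> * indicator ?P n"
      using n \<beta> by (auto split: split_indicator)
  qed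
  also have "\<dots> = ennreal \<beta> * emeasure (count_space (atom_index M \<beta>)) ?P"
    by (rule nn_integral_cmult_indicator) auto
  finally show ?thesis .
qed

lemma emeasure_atomic_cases:
  assumes "A \<in> sets M"
  obtains "emeasure M A = \<infinity>" | m :: nat where "emeasure M A = ennreal (\<beta> * real m)"
proof -
  let ?P = "{n \<in> atom_index M \<beta>. emeasure M (A \<inter> e n) = ennreal \<beta>}"
  show thesis
  proof (cases "finite ?P")
    case True
    then have "emeasure M A = ennreal (\<beta> * real (card ?P))"
      using \<beta> emeasure_atomic[OF assms]
      by (simp add: emeasure_count_space ennreal_mult' ennreal_of_nat_eq_real_of_nat)
    then show ?thesis by (rule that(2))
  next
    case False
    then have "emeasure M A = \<infinity>"
      using \<beta> emeasure_atomic[OF assms] by (simp add: emeasure_count_space ennreal_mult_top)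
    then show ?thesis by (rule that(1))
  qed
qed

text \<open>Each g_*(s) is infinite or of the form \<beta> m. For t in block n the inequality t <
  \<beta> m means n < m, so no level s separates the two values.\<close>

lemma rearr_const_on_block:
  assumes g[measurable]: "g \<in> borel_measurable M" and t: "t \<in> block n"
  shows "rearr M g t = rearr M g (\<beta> * real n)"
proof (rule ennreal_eq_if_less)
  fix s :: real assume s: "0 \<le> s"
  have A: "{x \<in> space M. ennreal s < g x} \<in> sets M" by measurable
  have "0 \<le> \<beta> * real n" using \<beta> by simp
  have "ennreal t < distrib_fun M g s \<longleftrightarrow> ennreal (\<beta> * real n) < distrib_fun M g s"
    unfolding distrib_fun_def
  proof (rule emeasure_atomic_cases[OF A])
    fix m :: nat
    assume m: "emeasure M {x \<in> space M. ennreal s < g x} = ennreal (\<beta> * real m)"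
    have "t < \<beta> * real m \<longleftrightarrow> \<beta> * real n < \<beta> * real m"
    proof
      assume "\<beta> * real n < \<beta> * real m"
      then have "real (Suc n) \<le> real m" using \<beta> by simp
      then have "\<beta> * real (Suc n) \<le> \<beta> * real m" using \<beta> by (intro mult_left_mono) auto
      then show "t < \<beta> * real m" using t by (simp add: block_def)
    qed (use t in \<open>auto simp: block_def\<close>)
    moreover have "0 \<le> t" using t \<open>0 \<le> \<beta> * real n\<close> by (simp add: block_def)
    ultimately show "ennreal t < emeasure M {x \<in> space M. ennreal s < g x} \<longleftrightarrow>
        ennreal (\<beta> * real n) < emeasure M {x \<in> space M. ennreal s < g x}"
      unfolding m using \<open>0 \<le> \<beta> * real n\<close> by (simp add: ennreal_less_iff)
  qed simp
  then show "ennreal s < rearr M g t \<longleftrightarrow> ennreal s < rearr M g (\<beta> * real n)"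
    by (simp add: less_rearr_iff s)
qed

lemma lift_rearr_eq:
  assumes g: "g \<in> borel_measurable M" and n: "n \<in> atom_index M \<beta>" and x: "x \<in> e n"
  shows "lift (rearr M g) x = rearr M g (\<beta> * real n)"
  unfolding T_op_eq[OF n x]
  by (rule avg_const_on_block) (simp add: prof_rearr[OF g] rearr_const_on_block[OF g])

text \<open>The lifted function equals g*(\<beta> n) on atom n, so its level set consists of the
  atoms with \<beta> n < g_*(s): the first m of them if g_*(s) = \<beta> m, and all if it is
  infinite.\<close>

lemma distrib_lift_rearr:
  assumes g[measurable]: "g \<in> borel_measurable M" and s: "0 \<le> s"
  shows "distrib_fun M (lift (rearr M g)) s = distrib_fun M g s"
proof -
  let ?d = "distrib_fun M g s"
  have d_le: "?d \<le> emeasure M (space M)" unfolding distrib_fun_def by (rule emeasure_space)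
  have eq: "{x \<in> space M. ennreal s < lift (rearr M g) x}
      = (\<Union>n\<in>{n \<in> atom_index M \<beta>. ennreal (\<beta> * real n) < ?d}. e n)"
  proof (intro set_eqI iffI)
    fix x assume "x \<in> {x \<in> space M. ennreal s < lift (rearr M g) x}"
    then have x: "x \<in> space M" "ennreal s < lift (rearr M g) x" by auto
    obtain n where n: "n \<in> atom_index M \<beta>" "x \<in> e n" using x(1) by (rule obtain_atom)
    then show "x \<in> (\<Union>n\<in>{n \<in> atom_index M \<beta>. ennreal (\<beta> * real n) < ?d}. e n)"
      using x lift_rearr_eq[OF g n] less_rearr_iff[OF g s] by auto
  next
    fix x assume "x \<in> (\<Union>n\<in>{n \<in> atom_index M \<beta>. ennreal (\<beta> * real n) < ?d}. e n)"
    then obtain n where n: "n \<in> atom_index M \<beta>" "x \<in> e n" "ennreal (\<beta> * real n) < ?d" by auto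
    then have "x \<in> space M" using cover by auto
    then show "x \<in> {x \<in> space M. ennreal s < lift (rearr M g) x}"
      using n lift_rearr_eq[OF g n(1,2)] less_rearr_iff[OF g s] by auto
  qed
  have A: "{x \<in> space M. ennreal s < g x} \<in> sets M" by measurable
  show ?thesis
  proof (rule emeasure_atomic_cases[OF A])
    assume inf: "emeasure M {x \<in> space M. ennreal s < g x} = \<infinity>"
    then have d: "?d = \<infinity>" by (simp add: distrib_fun_def)
    then have "{x \<in> space M. ennreal s < lift (rearr M g) x} = space M"
      unfolding eq using cover by simp
    then show ?thesis using d d_le by (simp add: distrib_fun_def[of M "lift _"] top_unique)
  next
    fix m :: nat
    assume "emeasure M {x \<in> space M. ennreal s < g x} = ennreal (\<beta> * real m)"
    then have d: "?d = ennreal (\<beta> * real m)" by (simp add: distrib_fun_def)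
    have "ennreal (\<beta> * real n) < ?d \<longleftrightarrow> n < m" for n
      unfolding d using \<beta> by (simp add: ennreal_less_iff)
    \<comment> \<open>The first m atoms exist because \<beta> m is at most \<mu>(R).\<close>
    then have idx: "{n \<in> atom_index M \<beta>. ennreal (\<beta> * real n) < ?d} = {..<m}"
      using d_le by (auto simp: atom_index_def intro: less_le_trans)
    then have sub: "{..<m} \<subseteq> atom_index M \<beta>" by auto
    have "emeasure M (\<Union>n\<in>{..<m}. e n) = (\<Sum>n<m. emeasure M (e n))"
      using sub disj by (intro sum_emeasure[symmetric]) (auto simp: disjoint_family_on_def subset_eq)
    also have "\<dots> = (\<Sum>n<m. ennreal \<beta>)" using sub atoms by (intro sum.cong) auto
    also have "\<dots> = ennreal (\<beta> * real m)"
      using \<beta> by (simp add: ennreal_of_nat_eq_real_of_nat ennreal_mult' mult.commute)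
    finally show ?thesis unfolding distrib_fun_def[of M "lift _"] eq idx using d by simp
  qed
qed

lemma lift_mono:
  assumes "p \<in> borel_measurable halfline" "q \<in> borel_measurable halfline"
    and "\<And>t. 0 \<le> t \<Longrightarrow> rearr halfline p t \<le> rearr halfline q t" and x: "x \<in> space M"
  shows "lift p x \<le> lift q x"
proof -
  obtain n where n: "n \<in> atom_index M \<beta>" "x \<in> e n" using x by (rule obtain_atom)
  show ?thesis unfolding T_op_eq[OF n] by (intro avg_mono prof_mono assms)
qed

sublocale rearrangement_representation M N Nb
proof (rule rearrangement_representation.intro)
  fix p q assume "p \<in> borel_measurable halfline" and "q \<in> borel_measurable halfline"
    and "\<And>t. 0 \<le> t \<Longrightarrow> rearr halfline p t \<le> rearr halfline q t"
  then show "Nb p \<le> Nb q"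
    unfolding Nb_eq by (intro qBFN_mono[OF qBFN] T_op_measurable lift_mono)
next
  fix g :: "'a \<Rightarrow> ennreal" assume g: "g \<in> borel_measurable M"
  show "Nb (rearr M g) = N g"
    unfolding Nb_eq by (intro rinv_eq_if_distrib_eq[OF rinv] T_op_measurable distrib_lift_rearr g)
qed (fact sigma_finite qBFN)+

text \<open>An unbounded f exceeds each n on some set of measure \<beta>. The indicators of these
  sets are equimeasurable, so every multiple of one fixed positive norm would lie below
  \<open>N f\<close>.\<close>

lemma essentially_bounded:
  assumes f[measurable]: "f \<in> borel_measurable M" and Nf: "N f < \<infinity>"
  obtains n :: nat where "distrib_fun M f (real n) = 0"
proof (rule ccontr)
  assume "\<not> thesis"
  then have pos: "distrib_fun M f (real n) \<noteq> 0" for n using that by blast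
  have "\<exists>B. B \<in> sets M \<and> B \<subseteq> {x \<in> space M. ennreal (real n) < f x} \<and> emeasure M B = ennreal \<beta>" for n
  proof -
    let ?A = "{x \<in> space M. ennreal (real n) < f x}"
    have A: "?A \<in> sets M" by measurable
    have "{i \<in> atom_index M \<beta>. emeasure M (?A \<inter> e i) = ennreal \<beta>} \<noteq> {}"
    proof
      assume "{i \<in> atom_index M \<beta>. emeasure M (?A \<inter> e i) = ennreal \<beta>} = {}"
      with emeasure_atomic[OF A] have "emeasure M ?A = 0" by (simp only: emeasure_empty mult_zero_right)
      then show False using pos[of n] by (simp add: distrib_fun_def)
    qed
    then obtain i where "i \<in> atom_index M \<beta>" "emeasure M (?A \<inter> e i) = ennreal \<beta>" by blast
    then show ?thesis using A by (intro exI[of _ "?A \<inter> e i"]) auto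
  qed
  then obtain B where B[measurable]: "\<And>n. B n \<in> sets M"
    and sub: "\<And>n. B n \<subseteq> {x \<in> space M. ennreal (real n) < f x}"
    and B_\<beta>: "\<And>n. emeasure M (B n) = ennreal \<beta>" by metis
  have distrib_ind: "distrib_fun M (indicator (B n)) s = (if s < 1 then ennreal \<beta> else 0)" if "0 \<le> s" for n s
  proof -
    have "{x \<in> space M. ennreal s < indicator (B n) x} = (if s < 1 then B n else {})"
      using sets.sets_into_space[OF B, of n] that
      by (auto simp: ennreal_less_iff ennreal_1[symmetric] split: split_indicator_asm split: split_indicator
          simp del: ennreal_1)
    then show ?thesis by (simp add: distrib_fun_def B_\<beta>)
  qed
  have "of_nat n * N (indicator (B 0)) \<le> N f" for n
  proof -
    have "N (indicator (B 0)) = N (indicator (B n))"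
      by (rule rinv_eq_if_distrib_eq[OF rinv]) (auto simp: distrib_ind)
    then have "of_nat n * N (indicator (B 0)) = N (\<lambda>x. ennreal (real n) * indicator (B n) x)"
      by (subst qBFN_scale[OF qBFN]) (auto simp: ennreal_of_nat_eq_real_of_nat)
    also have "\<dots> \<le> N f"
      by (rule qBFN_mono[OF qBFN]) (use sub[of n] in \<open>auto split: split_indicator intro: less_imp_le\<close>)
    finally show ?thesis .
  qed
  then have "N (indicator (B 0)) = 0" using Nf by (rule ennreal_bounded_multiples_eq_0)
  then have "AE x in M. indicator (B 0) x = (0::ennreal)" by (subst (asm) qBFN_eq_0_iff[OF qBFN]) auto
  then have "emeasure M {x \<in> space M. indicator (B 0) x \<noteq> (0::ennreal)} = 0"
    by (subst (asm) AE_iff_measurable[OF _ refl]) auto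
  moreover have "{x \<in> space M. indicator (B 0) x \<noteq> (0::ennreal)} = B 0"
    using sets.sets_into_space[OF B, of 0] by (auto split: split_indicator_asm)
  ultimately show False using B_\<beta>[of 0] \<beta> by simp
qed

text \<open>The essential bound of f is the integrable majorant on block 0; it turns convergence at
  each t > 0 into convergence of the first average, which dominates all others.\<close>

lemma Nb_vanishing_rearr:
  assumes f[measurable]: "f \<in> borel_measurable M" and Nf: "N f < \<infinity>"
    and ac: "abs_cont M N f \<or> abs_cont halfline Nb (rearr M f)"
    and p: "\<And>k::nat. p k \<in> borel_measurable halfline"
    and le: "\<And>k t. rearr halfline (p k) t \<le> rearr M f t"
    and lim: "\<And>t. t > 0 \<Longrightarrow> (\<lambda>k. rearr halfline (p k) t) \<longlonglongrightarrow> 0"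
  shows "(\<lambda>k. Nb (p k)) \<longlonglongrightarrow> 0"
proof (rule tendsto_0_ennrealI[where D = 1])
  fix \<epsilon> :: real assume \<epsilon>: "\<epsilon> > 0"
  obtain s where s: "s > 0" and Ns: "N (\<lambda>x. min (f x) (ennreal s)) \<le> ennreal \<epsilon>"
    using truncation_small[OF f Nf abs_cont_cuts(2)[OF f Nf ac] \<epsilon>] by auto
  let ?g = "lift (rearr M f)"
  have Ng: "N (\<lambda>x. min (?g x) (ennreal s)) \<le> ennreal \<epsilon>"
  proof -
    have "N (\<lambda>x. min (?g x) (ennreal s)) = N (\<lambda>x. min (f x) (ennreal s))"
      by (rule rinv_eq_if_distrib_eq[OF rinv]) (use s in \<open>auto simp: distrib_min distrib_lift_rearr[OF f]\<close>)
    with Ns show ?thesis by simp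
  qed
  have p_f: "rearr halfline (p k) t \<le> rearr halfline (rearr M f) t" for k t
    using le by (simp add: rearr_rearr f)
  obtain n :: nat where n: "distrib_fun M f (real n) = 0" using essentially_bounded[OF f Nf] by blast
  have bound: "rearr halfline (p k) t \<le> ennreal (real n)" for k t
  proof -
    have "\<not> ennreal (real n) < rearr M f t" using less_rearr_iff[OF f, of "real n" t] n by simp
    then show ?thesis using le[of k t] by (simp add: not_less order.trans)
  qed
  have prof_m: "prof (p k) \<in> borel_measurable borel" for k
    by (intro rearr_borel_measurable prof_fun_measurable p)
  have "(\<lambda>k. \<integral>\<^sup>+ t. prof (p k) t * indicator (block 0) t \<partial>lborel) \<longlonglongrightarrow> (\<integral>\<^sup>+ t. 0 \<partial>(lborel :: real measure))"
  proof (rule nn_integral_dominated_convergence[where w = "\<lambda>t. ennreal (real n) * indicator (block 0) t"])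
    show "AE t in lborel. (\<lambda>k. prof (p k) t * indicator (block 0) t) \<longlonglongrightarrow> 0"
      using AE_lborel_singleton[of "0::real"]
    proof eventually_elim
      case (elim t)
      show ?case
      proof (cases "t \<in> block 0")
        case True
        then have "t > 0" using elim by (auto simp: block_def)
        have "(\<lambda>k. prof (p k) t) \<longlonglongrightarrow> 0"
          by (rule tendsto_sandwich[OF _ _ tendsto_const lim[OF \<open>t > 0\<close>]]) (use prof_le[OF p] in auto)
        with True show ?thesis by simp
      qed simp
    qed
    show "AE t in lborel. prof (p k) t * indicator (block 0) t \<le> ennreal (real n) * indicator (block 0) t" for k
      by (intro AE_I2 mult_right_mono order.trans[OF prof_le[OF p] bound]) auto
    show "(\<integral>\<^sup>+ t. ennreal (real n) * indicator (block 0) t \<partial>lborel) < \<infinity>"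
      by (subst nn_integral_cmult_indicator)
        (auto simp: block_measure ennreal_mult_less_top)
  qed (use prof_m in measurable)
  then have "(\<lambda>k. \<integral>\<^sup>+ t. prof (p k) t * indicator (block 0) t \<partial>lborel) \<longlonglongrightarrow> 0" by simp
  \<comment> \<open>Divided by \<beta>, this threshold bounds the first average by the truncation
    level s.\<close>
  then have "eventually (\<lambda>k. (\<integral>\<^sup>+ t. prof (p k) t * indicator (block 0) t \<partial>lborel) < ennreal (s * \<beta>)) sequentially"
    by (rule order_tendstoD) (use s \<beta> in simp)
  then show "eventually (\<lambda>k. Nb (p k) \<le> ennreal (1 * \<epsilon>)) sequentially"
  proof eventually_elim
    case (elim k)
    have "avg 0 (prof (p k)) \<le> ennreal (s * \<beta>) / ennreal \<beta>"
      unfolding avg_def using elim by (intro divide_right_mono_ennreal) simp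
    also have "\<dots> = ennreal s" using s \<beta> by (simp add: divide_ennreal)
    finally have a0: "avg 0 (prof (p k)) \<le> ennreal s" .
    have "Nb (p k) \<le> N (\<lambda>x. min (?g x) (ennreal s))"
      unfolding Nb_eq
    proof (rule qBFN_mono[OF qBFN])
      fix x assume x: "x \<in> space M"
      obtain i where i: "i \<in> atom_index M \<beta>" "x \<in> e i" using x by (rule obtain_atom)
      have "lift (p k) x \<le> avg 0 (prof (p k))"
        unfolding T_op_eq[OF i] by (intro avg_le_avg_0 rearr_antimono prof_fun_measurable p)
      moreover have "lift (p k) x \<le> ?g x"
        by (intro lift_mono p rearr_measurable_halfline f p_f x)
      ultimately show "lift (p k) x \<le> min (?g x) (ennreal s)" using a0 by simp
    qed measurable
    with Ng show ?case by simp
  qed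
qed simp

end

theorem mainTheorem7:
  fixes M :: "'a measure" and N :: "('a \<Rightarrow> ennreal) \<Rightarrow> ennreal"
    and Nbar :: "(real \<Rightarrow> ennreal) \<Rightarrow> ennreal" and f :: "'a \<Rightarrow> ennreal"
  assumes "sigma_finite_measure M"
    and "qBFN M N" and "rinv M N"
    and "Xbar_construction M N Nbar"
    and "f \<in> borel_measurable M" and "N f < \<infinity>"
  shows "abs_cont M N f \<longleftrightarrow> abs_cont halfline Nbar (rearr M f)"
proof -
  have "abs_cont M N f \<and> abs_cont halfline Nbar (rearr M f)"
    if ac: "abs_cont M N f \<or> abs_cont halfline Nbar (rearr M f)"
    using assms(4) unfolding Xbar_construction_def
  proof (elim disjE exE conjE)
    fix \<sigma> assume "measure_preserving M \<sigma>" and Nbar: "Nbar = Xbar_of M (Xbar0_nonatomic N \<sigma>)"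
    then interpret nonatomic_representation M N \<sigma> using assms by (intro nonatomic_representation.intro)
    note ac' = ac[unfolded Nbar]
    show ?thesis
      unfolding Nbar
      using abs_cont_of_vanishing_rearr[OF assms(5,6) abs_cont_cuts(1)[OF assms(5,6) ac']
          Nb_vanishing_rearr[OF assms(5,6) ac']] by blast
  next
    fix \<beta> e assume "0 < \<beta>"
      "\<forall>n\<in>atom_index M \<beta>. atom M (e n) \<and> emeasure M (e n) = ennreal \<beta>"
      "disjoint_family_on e (atom_index M \<beta>)" "(\<Union>n\<in>atom_index M \<beta>. e n) = space M"
      and Nbar: "Nbar = Xbar_of M (Xbar0_atomic M N \<beta> e)"
    then interpret atomic_representation M N \<beta> e using assms
      by (intro atomic_representation.intro) auto
    note ac' = ac[unfolded Nbar]
    show ?thesis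
      unfolding Nbar
      using abs_cont_of_vanishing_rearr[OF assms(5,6) abs_cont_cuts(1)[OF assms(5,6) ac']
          Nb_vanishing_rearr[OF assms(5,6) ac']] by blast
  qed
  then show ?thesis by blast
qed

end
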